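(* Let $G$ be a locally weakly modular graph, and let $\widetilde G$ be the $1$--skeleton of the universal cover $\widetilde X_{\triangle\square}(G)$ of the triangle-square complex $X_{\triangle\square}(G)$ of $G$. Then $\widetilde G$ is weakly modular. In particular, a graph $G$ is weakly modular if and only if $G$ is locally weakly modular and its triangle-square complex $X_{\triangle\square}(G)$ is simply connected.
   Context: All graphs are simple, undirected, connected, not necessarily finite or locally finite; $d$ denotes the graph distance. A graph is weakly modular if for every vertex $u$ it satisfies: (TC($u$)) for any two vertices $v,w$ with $1=d(v,w)<d(u,v)=d(u,w)$ there is a common neighbor $x$ of $v,w$ with $d(u,x)=d(u,v)-1$; (QC($u$)) for any vertices $v,w,z$ with $d(v,z)=d(w,z)=1$ and $2=d(v,w)\le d(u,v)=d(u,w)=d(u,z)-1$ there is a common neighbor $x$ of $v,w$ with $d(u,x)=d(u,v)-1$. A graph is locally weakly modular if for every vertex $u$: (LTC($u$)) for any adjacent $v,w$ with $d(u,v)=d(u,w)=2$ there is a common neighbor of $u,v,w$; (LQC($u$)) for any $v,w,z$ with $z$ adjacent to $v,w$ and $d(v,w)=d(u,v)=d(u,w)=d(u,z)-1=2$ there is a common neighbor of $u,v,w$. A square is an induced $4$--cycle and a triangle is a $3$--cycle. The triangle-square complex $X_{\triangle\square}(G)$ is the $2$--dimensional cell complex with $1$--skeleton $G$ whose $2$--cells are solid triangles and solid squares glued along all triangles and all squares of $G$. A covering of a cell complex $X$ is a cellular surjection $p:\widetilde X\to X$ restricting to an isomorphism from the star of each vertex of $\widetilde X$ onto the star of its image; the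 universal cover is the simply connected covering space. *)

theory Defs
  imports Main
begin

definition sgraph :: "('a \<Rightarrow> 'a \<Rightarrow> bool) \<Rightarrow> bool" where
  "sgraph E \<longleftrightarrow> (\<forall>x y. E x y \<longrightarrow> E y x) \<and> (\<forall>x. \<not> E x x)"

definition is_walk :: "('a \<Rightarrow> 'a \<Rightarrow> bool) \<Rightarrow> 'a list \<Rightarrow> bool" where
  "is_walk E xs \<longleftrightarrow> xs \<noteq> [] \<and> (\<forall>i. Suc i < length xs \<longrightarrow> E (xs ! i) (xs ! Suc i))"

definition connected_graph :: "('a \<Rightarrow> 'a \<Rightarrow> bool) \<Rightarrow> bool" where
  "connected_graph E \<longleftrightarrow> (\<forall>u v. \<exists>xs. is_walk E xs \<and> hd xs = u \<and> last xs = v)"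

text \<open>Graph distance (number of edges of a shortest walk); meaningful for connected graphs.\<close>
definition gdist :: "('a \<Rightarrow> 'a \<Rightarrow> bool) \<Rightarrow> 'a \<Rightarrow> 'a \<Rightarrow> nat" where
  "gdist E u v = (LEAST n. \<exists>xs. is_walk E xs \<and> hd xs = u \<and> last xs = v \<and> length xs = Suc n)"

definition TC :: "('a \<Rightarrow> 'a \<Rightarrow> bool) \<Rightarrow> 'a \<Rightarrow> bool" where
  "TC E u \<longleftrightarrow> (\<forall>v w. gdist E v w = 1 \<and> 1 < gdist E u v \<and> gdist E u v = gdist E u w \<longrightarrow>
     (\<exists>x. E x v \<and> E x w \<and> gdist E u x = gdist E u v - 1))"

definition QC :: "('a \<Rightarrow> 'a \<Rightarrow> bool) \<Rightarrow> 'a \<Rightarrow> bool" where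
  "QC E u \<longleftrightarrow> (\<forall>v w z. gdist E v z = 1 \<and> gdist E w z = 1 \<and> gdist E v w = 2 \<and>
     gdist E v w \<le> gdist E u v \<and> gdist E u v = gdist E u w \<and> gdist E u z = gdist E u v + 1 \<longrightarrow>
     (\<exists>x. E x v \<and> E x w \<and> gdist E u x = gdist E u v - 1))"

definition weakly_modular :: "('a \<Rightarrow> 'a \<Rightarrow> bool) \<Rightarrow> bool" where
  "weakly_modular E \<longleftrightarrow> (\<forall>u. TC E u \<and> QC E u)"

definition LTC :: "('a \<Rightarrow> 'a \<Rightarrow> bool) \<Rightarrow> 'a \<Rightarrow> bool" where
  "LTC E u \<longleftrightarrow> (\<forall>v w. E v w \<and> gdist E u v = 2 \<and> gdist E u w = 2 \<longrightarrow>
     (\<exists>x. E x u \<and> E x v \<and> E x w))"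

definition LQC :: "('a \<Rightarrow> 'a \<Rightarrow> bool) \<Rightarrow> 'a \<Rightarrow> bool" where
  "LQC E u \<longleftrightarrow> (\<forall>v w z. E z v \<and> E z w \<and> gdist E v w = 2 \<and> gdist E u v = 2 \<and>
     gdist E u w = 2 \<and> gdist E u z = 3 \<longrightarrow> (\<exists>x. E x u \<and> E x v \<and> E x w))"

definition locally_weakly_modular :: "('a \<Rightarrow> 'a \<Rightarrow> bool) \<Rightarrow> bool" where
  "locally_weakly_modular E \<longleftrightarrow> (\<forall>u. LTC E u \<and> LQC E u)"

text \<open>Combinatorial 2-complexes: a graph together with a set of 2-cells, each cell
recorded by its vertex set (its boundary cycle runs through these vertices).
The triangle-square complex has as 2-cells all triangles and all squares
(induced 4-cycles).\<close>

definition tsq_cells :: "('a \<Rightarrow> 'a \<Rightarrow> bool) \<Rightarrow> 'a set set" where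
  "tsq_cells E =
     {K. \<exists>a b c. K = {a, b, c} \<and> E a b \<and> E b c \<and> E a c}
   \<union> {K. \<exists>a b c d. K = {a, b, c, d} \<and> E a b \<and> E b c \<and> E c d \<and> E d a \<and>
         a \<noteq> c \<and> b \<noteq> d \<and> \<not> E a c \<and> \<not> E b d}"

definition star_vs :: "('a \<Rightarrow> 'a \<Rightarrow> bool) \<Rightarrow> 'a set set \<Rightarrow> 'a \<Rightarrow> 'a set" where
  "star_vs E D v = {v} \<union> {w. E v w} \<union> \<Union>{K \<in> D. v \<in> K}"

definition star_edge :: "('a \<Rightarrow> 'a \<Rightarrow> bool) \<Rightarrow> 'a set set \<Rightarrow> 'a \<Rightarrow> 'a \<Rightarrow> 'a \<Rightarrow> bool" where
  "star_edge E D v x y \<longleftrightarrow> E x y \<and> (x = v \<or> y = v \<or> (\<exists>K \<in> D. v \<in> K \<and> x \<in> K \<and> y \<in> K))"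

definition is_covering ::
  "('b \<Rightarrow> 'b \<Rightarrow> bool) \<Rightarrow> 'b set set \<Rightarrow> ('a \<Rightarrow> 'a \<Rightarrow> bool) \<Rightarrow> 'a set set \<Rightarrow> ('b \<Rightarrow> 'a) \<Rightarrow> bool" where
  "is_covering F D E C p \<longleftrightarrow>
     surj p \<and> (\<forall>x y. F x y \<longrightarrow> E (p x) (p y)) \<and> (\<forall>K \<in> D. p ` K \<in> C) \<and>
     (\<forall>v. inj_on p (star_vs F D v) \<and> p ` star_vs F D v = star_vs E C (p v) \<and>
          (\<forall>x \<in> star_vs F D v. \<forall>y \<in> star_vs F D v.
               star_edge F D v x y \<longleftrightarrow> star_edge E C (p v) (p x) (p y)) \<and>
          bij_betw (image p) {K \<in> D. v \<in> K} {L \<in> C. p v \<in> L})"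

definition cell_loop :: "('a \<Rightarrow> 'a \<Rightarrow> bool) \<Rightarrow> 'a set \<Rightarrow> 'a list \<Rightarrow> bool" where
  "cell_loop E K c \<longleftrightarrow> finite K \<and> is_walk E c \<and> length c = Suc (card K) \<and>
     hd c = last c \<and> distinct (butlast c) \<and> set c = K"

definition htpy_step :: "('a \<Rightarrow> 'a \<Rightarrow> bool) \<Rightarrow> 'a set set \<Rightarrow> 'a list \<Rightarrow> 'a list \<Rightarrow> bool" where
  "htpy_step E D xs ys \<longleftrightarrow>
     (\<exists>as bs x y. E x y \<and> xs = as @ [x] @ bs \<and> ys = as @ [x, y, x] @ bs) \<or>
     (\<exists>as bs K c. K \<in> D \<and> cell_loop E K c \<and> xs = as @ [hd c] @ bs \<and> ys = as @ c @ bs)"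

definition simply_connected :: "('a \<Rightarrow> 'a \<Rightarrow> bool) \<Rightarrow> 'a set set \<Rightarrow> bool" where
  "simply_connected E D \<longleftrightarrow> connected_graph E \<and>
     (\<forall>xs. is_walk E xs \<and> hd xs = last xs \<longrightarrow>
        (\<lambda>a b. htpy_step E D a b \<or> htpy_step E D b a)\<^sup>*\<^sup>* xs [hd xs])"

end

theory Submission
  imports Defs
begin

text \<open>
  The universal cover is built from walks by rewriting. Two walks are identified if they differ by a sequence of
  moves, each replacing an interior vertex by another common neighbour of its two neighbours on the
  walk. A walk is irreducible if no walk equivalent to it has three consecutive vertices
  \<open>a, b, c\<close> with \<open>a = c\<close> or \<open>a\<close> adjacent to \<open>c\<close>. By local weak modularity, irreducible walks
  satisfy the quadrangle condition with respect to walk length (if \<open>z v \<dots>\<close> and \<open>z w \<dots>\<close> are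
  equivalent, the two tails pass, up to equivalence, through a common neighbour of \<open>v\<close> and \<open>w\<close>),
  and every edge at the end vertex of an irreducible walk determines a unique adjacent class:
  one step longer, one step shorter, or of the same length with the same predecessor. This makes the
  classes of irreducible walks into a graph to which triangles and 4-cycles lift as closed walks.
  Hence the end point of a lift depends only on the homotopy class, so in a simply connected graph
  irreducible walks with the same ends are equivalent. Geodesics are irreducible, and the conditions
  TC and QC can be read off.

  Walks are written backwards: the head of a list is the end of the walk.
\<close>

section \<open>Graph distance and geodesics\<close>

locale simple_graph =
  fixes E :: "'a \<Rightarrow> 'a \<Rightarrow> bool"
  assumes sgraph: "sgraph E"
begin

lemma sym: "E x y \<Longrightarrow> E y x"
  using sgraph unfolding sgraph_def by blast

lemma irrefl: "\<not> E x x"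
  using sgraph unfolding sgraph_def by blast

text \<open>The recursive form of \<open>is_walk\<close>. Its case and induction rules, which
  separate lists of length zero, one and more, carry most of the later arguments.\<close>

fun walk :: "'a list \<Rightarrow> bool" where
  "walk [] \<longleftrightarrow> False"
| "walk [a] \<longleftrightarrow> True"
| "walk (a # b # xs) \<longleftrightarrow> E a b \<and> walk (b # xs)"

lemma is_walk_iff_walk: "is_walk E xs \<longleftrightarrow> walk xs"
proof (induction xs rule: walk.induct)
  case (3 a b xs)
  have "is_walk E (a # b # xs) \<longleftrightarrow> E a b \<and> is_walk E (b # xs)"
    unfolding is_walk_def by (auto simp: nth_Cons split: nat.splits)
  then show ?case using 3 by simp
qed (simp_all add: is_walk_def)

lemma walk_ne: "walk xs \<Longrightarrow> xs \<noteq> []"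
  by auto

lemma walk_append: "walk (as @ x # bs) \<longleftrightarrow> walk (as @ [x]) \<and> walk (x # bs)"
  by (induction as rule: walk.induct) auto

lemma walk_rev: "walk xs \<Longrightarrow> walk (rev xs)"
proof (induction xs rule: walk.induct)
  case (3 a b xs)
  then show ?case using walk_append[of "rev xs" b "[a]"] sym[of a b] by simp
qed simp_all

text \<open>The distance runs from \<open>last\<close> to \<open>hd\<close> because walks are stored
  backwards; reversal gives the walk that \<open>gdist\<close> counts. The strict form avoids a
  subtraction from the number of vertices.\<close>

lemma gdist_less_length:
  assumes "walk xs"
  shows "gdist E (last xs) (hd xs) < length xs"
proof -
  have "gdist E (last xs) (hd xs) \<le> length xs - 1"
    unfolding gdist_def using walk_rev[OF assms] walk_ne[OF assms]
    by (intro Least_le exI[of _ "rev xs"]) (simp add: is_walk_iff_walk hd_rev last_rev)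
  then show ?thesis using walk_ne[OF assms] by (cases xs) auto
qed

end

locale connected_simple_graph = simple_graph +
  assumes connected: "connected_graph E"
begin

definition geodesic :: "'a list \<Rightarrow> bool" where
  "geodesic xs \<longleftrightarrow> walk xs \<and> length xs = Suc (gdist E (last xs) (hd xs))"

lemma ex_geodesic: "\<exists>xs. geodesic xs \<and> last xs = u \<and> hd xs = v"
proof -
  obtain ys where "is_walk E ys \<and> hd ys = u \<and> last ys = v" using connected unfolding connected_graph_def by blast
  then have "\<exists>n. \<exists>xs. is_walk E xs \<and> hd xs = u \<and> last xs = v \<and> length xs = Suc n"
    using walk_ne is_walk_iff_walk by (metis Suc_pred length_greater_0_conv)
  from LeastI_ex[OF this] obtain xs where
    xs: "walk xs" "hd xs = u" "last xs = v" "length xs = Suc (gdist E u v)"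
    unfolding is_walk_iff_walk gdist_def by blast
  then have "geodesic (rev xs)"
    using walk_rev walk_ne unfolding geodesic_def by (simp add: hd_rev last_rev)
  then show ?thesis using xs walk_ne by (metis hd_rev last_rev)
qed

lemma gdist_step: "E w v \<Longrightarrow> gdist E u w \<le> Suc (gdist E u v)"
proof -
  assume e: "E w v"
  obtain xs where xs: "geodesic xs" "last xs = u" "hd xs = v" using ex_geodesic by blast
  then have "walk (w # xs)" using e unfolding geodesic_def by (cases xs) auto
  from gdist_less_length[OF this] show ?thesis using xs walk_ne unfolding geodesic_def by auto
qed

lemma geodesic_tl:
  assumes "geodesic (z # v # \<alpha>)"
  shows "geodesic (v # \<alpha>)" "gdist E (last (v # \<alpha>)) z = Suc (gdist E (last (v # \<alpha>)) v)"
proof -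
  have w: "walk (v # \<alpha>)" "E z v" using assms unfolding geodesic_def by auto
  show "geodesic (v # \<alpha>)" "gdist E (last (v # \<alpha>)) z = Suc (gdist E (last (v # \<alpha>)) v)"
    using assms gdist_less_length[OF w(1)] gdist_step[OF w(2), of "last (v # \<alpha>)"] w
    unfolding geodesic_def by auto
qed

lemma geodesic_Cons:
  "\<lbrakk>geodesic (v # \<alpha>); E z v; gdist E (last (v # \<alpha>)) z = Suc (gdist E (last (v # \<alpha>)) v)\<rbrakk>
    \<Longrightarrow> geodesic (z # v # \<alpha>)"
  unfolding geodesic_def by simp

lemma gdist_0: "gdist E u v = 0 \<longleftrightarrow> u = v"
proof
  assume "gdist E u v = 0"
  moreover obtain xs where "geodesic xs" "last xs = u" "hd xs = v" using ex_geodesic by blast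
  ultimately show "u = v" unfolding geodesic_def by (cases xs) auto
next
  assume "u = v" then show "gdist E u v = 0" using gdist_less_length[of "[u]"] by simp
qed

lemma gdist_Suc:
  assumes "gdist E u v = Suc n"
  obtains x where "E x v" "gdist E u x = n"
proof -
  obtain xs where "geodesic xs" "last xs = u" "hd xs = v" using ex_geodesic by blast
  then obtain x \<alpha> where "geodesic (v # x # \<alpha>)" "last (x # \<alpha>) = u"
    using assms unfolding geodesic_def by (cases xs rule: walk.cases) auto
  then show thesis using geodesic_tl[of v x \<alpha>] assms that sym unfolding geodesic_def by auto
qed

lemma gdist_1: "gdist E u v = 1 \<longleftrightarrow> E u v"
proof
  assume "gdist E u v = 1"
  then show "E u v" using gdist_Suc[of u v 0] gdist_0 by auto
next
  assume e: "E u v"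
  then have "gdist E u v \<le> 1" using gdist_step[of v u u] gdist_0[of u u] sym by simp
  moreover have "gdist E u v \<noteq> 0" using e gdist_0 irrefl by metis
  ultimately show "gdist E u v = 1" by simp
qed

lemma gdist_2: "gdist E u v = 2 \<longleftrightarrow> u \<noteq> v \<and> \<not> E u v \<and> (\<exists>c. E u c \<and> E c v)"
proof
  assume a: "gdist E u v = 2"
  then obtain c where "E c v" "gdist E u c = 1" using gdist_Suc[of u v 1] by auto
  then show "u \<noteq> v \<and> \<not> E u v \<and> (\<exists>c. E u c \<and> E c v)" using a gdist_0[of u v] gdist_1[of u v] gdist_1[of u c] by auto
next
  assume a: "u \<noteq> v \<and> \<not> E u v \<and> (\<exists>c. E u c \<and> E c v)"
  then obtain c where "E u c" "E c v" by blast
  then have "gdist E u v \<le> 2" using gdist_step[of v c u] gdist_1[of u c] sym[of c v] by simp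
  moreover have "gdist E u v \<noteq> 0" "gdist E u v \<noteq> 1" using a gdist_0 gdist_1 by auto
  ultimately show "gdist E u v = 2" by simp
qed

section \<open>Consequences of weak modularity\<close>

lemma wm_locally_wm:
  assumes "weakly_modular E"
  shows "locally_weakly_modular E"
  unfolding locally_weakly_modular_def
proof (intro allI conjI)
  fix u
  have TC: "TC E u" and QC: "QC E u" using assms unfolding weakly_modular_def by auto
  show "LTC E u"
    unfolding LTC_def
  proof (intro allI impI)
    fix v w assume "E v w \<and> gdist E u v = 2 \<and> gdist E u w = 2"
    then have "\<exists>x. E x v \<and> E x w \<and> gdist E u x = 1"
      using TC[unfolded TC_def, rule_format, of v w] gdist_1 by simp
    then show "\<exists>x. E x u \<and> E x v \<and> E x w" using gdist_1 sym by blast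
  qed
  show "LQC E u"
    unfolding LQC_def
  proof (intro allI impI)
    fix v w z assume "E z v \<and> E z w \<and> gdist E v w = 2 \<and> gdist E u v = 2 \<and> gdist E u w = 2 \<and> gdist E u z = 3"
    then have "\<exists>x. E x v \<and> E x w \<and> gdist E u x = 1"
      using QC[unfolded QC_def, rule_format, of v z w] gdist_1 sym by simp
    then show "\<exists>x. E x u \<and> E x v \<and> E x w" using gdist_1 sym by blast
  qed
qed

text \<open>TC extended to distance one, where \<open>u\<close> itself is the common neighbour, so
  that later descents need no separate case.\<close>

lemma wm_triangle:
  assumes "weakly_modular E" "E v w" "gdist E u v = Suc n" "gdist E u w = Suc n"
  obtains x where "E x v" "E x w" "gdist E u x = n"
proof (cases "n = 0")
  case True
  then show ?thesis using that[of u] assms gdist_1 gdist_0[of u u] by simp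
next
  case False
  have "TC E u" using assms unfolding weakly_modular_def by auto
  then show ?thesis using that False assms(2-4) gdist_1[of v w] unfolding TC_def by fastforce
qed

text \<open>One descent step for any two distinct predecessors of \<open>z\<close>: adjacent ones
  fall under TC, neighbours of \<open>u\<close> have \<open>u\<close> itself in common, and the rest
  is QC. Distinctness rules out \<open>n = 0\<close>.\<close>

lemma wm_quadrangle:
  assumes "weakly_modular E" "E v z" "E w z" "v \<noteq> w" "gdist E u v = n" "gdist E u w = n" "gdist E u z = Suc n"
  obtains x m where "E x v" "E x w" "gdist E u x = m" "n = Suc m"
proof (cases n)
  case 0
  then show ?thesis using assms gdist_0 by auto
next
  case (Suc m)
  show ?thesis
  proof (cases "E v w")
    case True
    then show ?thesis using wm_triangle[OF assms(1) True, of u m] assms Suc that by metis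
  next
    case nvw: False
    show ?thesis
    proof (cases "m = 0")
      case True
      then show ?thesis using that[of u 0] assms Suc gdist_1 gdist_0[of u u] by simp
    next
      case False
      have "QC E u" using assms unfolding weakly_modular_def by auto
      moreover have "gdist E v w = 2" using gdist_2[of v w] assms nvw sym by blast
      ultimately show ?thesis
        using that[OF _ _ _ Suc] Suc False assms(5-7) gdist_1[of v z] gdist_1[of w z] assms(2,3)
        unfolding QC_def by fastforce
    qed
  qed
qed

section \<open>Contracting walks in weakly modular graphs\<close>

abbreviation htpy :: "'a list \<Rightarrow> 'a list \<Rightarrow> bool" (infix "\<simeq>" 50) where
  "htpy \<equiv> (\<lambda>a b. htpy_step E (tsq_cells E) a b \<or> htpy_step E (tsq_cells E) b a)\<^sup>*\<^sup>*"

lemma htpy_sym: "xs \<simeq> ys \<Longrightarrow> ys \<simeq> xs"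
  by (rule sympD[OF symp_rtranclp]) (auto intro: sympI)

lemma htpy_step_context: "htpy_step E D xs ys \<Longrightarrow> htpy_step E D (as @ xs @ bs) (as @ ys @ bs)"
  unfolding htpy_step_def
proof (elim disjE exE conjE)
  fix as' bs' x y
  assume "E x y" "xs = as' @ [x] @ bs'" "ys = as' @ [x, y, x] @ bs'"
  then show "(\<exists>as' bs' x y. E x y \<and> as @ xs @ bs = as' @ [x] @ bs' \<and> as @ ys @ bs = as' @ [x, y, x] @ bs') \<or>
    (\<exists>as' bs' K c. K \<in> D \<and> cell_loop E K c \<and> as @ xs @ bs = as' @ [hd c] @ bs' \<and> as @ ys @ bs = as' @ c @ bs')"
    by (intro disjI1 exI[of _ "as @ as'"] exI[of _ "bs' @ bs"] exI[of _ x] exI[of _ y]) simp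
next
  fix as' bs' K c
  assume "K \<in> D" "cell_loop E K c" "xs = as' @ [hd c] @ bs'" "ys = as' @ c @ bs'"
  then show "(\<exists>as' bs' x y. E x y \<and> as @ xs @ bs = as' @ [x] @ bs' \<and> as @ ys @ bs = as' @ [x, y, x] @ bs') \<or>
    (\<exists>as' bs' K c. K \<in> D \<and> cell_loop E K c \<and> as @ xs @ bs = as' @ [hd c] @ bs' \<and> as @ ys @ bs = as' @ c @ bs')"
    by (intro disjI2 exI[of _ "as @ as'"] exI[of _ "bs' @ bs"] exI[of _ K] exI[of _ c]) simp
qed

lemma htpy_context: "xs \<simeq> ys \<Longrightarrow> as @ xs @ bs \<simeq> as @ ys @ bs"
proof (induction rule: rtranclp_induct)
  case (step ys zs)
  have "htpy_step E (tsq_cells E) (as @ ys @ bs) (as @ zs @ bs) \<or>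
      htpy_step E (tsq_cells E) (as @ zs @ bs) (as @ ys @ bs)"
    using step.hyps(2) htpy_step_context by blast
  then show ?case by (rule rtranclp.rtrancl_into_rtrancl[OF step.IH])
qed simp

lemma htpy_Cons: "xs \<simeq> ys \<Longrightarrow> x # xs \<simeq> x # ys"
  using htpy_context[of xs ys "[x]" "[]"] by simp

lemma htpy_backtrack: "E x y \<Longrightarrow> x # y # x # xs \<simeq> x # xs"
proof -
  assume "E x y"
  then have "htpy_step E (tsq_cells E) (x # xs) (x # y # x # xs)"
    unfolding htpy_step_def
    by (intro disjI1 exI[of _ "[]"] exI[of _ xs] exI[of _ x] exI[of _ y]) simp
  then show ?thesis by blast
qed

lemma htpy_cell:
  assumes "K \<in> tsq_cells E" "cell_loop E K (x # ys)"
  shows "x # ys @ xs \<simeq> x # xs"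
proof -
  have "htpy_step E (tsq_cells E) (x # xs) (x # ys @ xs)"
    unfolding htpy_step_def using assms
    by (intro disjI2 exI[of _ "[]"] exI[of _ xs] exI[of _ K] exI[of _ "x # ys"]) simp
  then show ?thesis by blast
qed

text \<open>Insert the backtrack \<open>c, a, c\<close>, then contract the closed walk
  \<open>a, b, c, a\<close>.\<close>

lemma htpy_triangle:
  assumes "E a b" "E b c" "E a c"
  shows "a # b # c # xs \<simeq> a # c # xs"
proof -
  have e: "E c a" "a \<noteq> b" "b \<noteq> c" "a \<noteq> c" using assms sym irrefl by metis+
  have "{a, b, c} \<in> tsq_cells E" unfolding tsq_cells_def using assms by blast
  moreover have "cell_loop E {a, b, c} (a # [b, c, a])"
    unfolding cell_loop_def is_walk_iff_walk using assms e by auto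
  ultimately have "a # [b, c, a] @ c # xs \<simeq> a # c # xs" by (rule htpy_cell)
  moreover have "a # b # c # a # c # xs \<simeq> a # b # c # xs"
    using htpy_Cons[OF htpy_Cons[OF htpy_backtrack[OF e(1)]]] .
  ultimately show ?thesis using htpy_sym rtranclp_trans by fastforce
qed

text \<open>The closed walk \<open>a, b, c, b', a\<close> either degenerates to backtracks, is cut
  by a diagonal into two triangles, or bounds a square cell.\<close>

lemma htpy_swap:
  assumes "E a b" "E b c" "E a b'" "E b' c"
  shows "a # b # c # xs \<simeq> a # b' # c # xs"
proof -
  consider "a = c" | "b = b'" | "E a c" | "E b b'" | "a \<noteq> c" "b \<noteq> b'" "\<not> E a c" "\<not> E b b'" by blast
  then show ?thesis
  proof cases
    case 1
    then show ?thesis using htpy_backtrack htpy_sym assms by (meson rtranclp_trans)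
  next
    case 3
    then show ?thesis
      using rtranclp_trans[OF htpy_triangle[OF assms(1,2)] htpy_sym[OF htpy_triangle[OF assms(3,4)]]] by blast
  next
    case 4
    have "a # b' # b # c # xs \<simeq> a # b # c # xs" using htpy_triangle[OF assms(3) sym[OF 4] assms(1)] .
    moreover have "a # b' # b # c # xs \<simeq> a # b' # c # xs"
      using htpy_Cons[OF htpy_triangle[OF sym[OF 4] assms(2,4)]] .
    ultimately show ?thesis using htpy_sym rtranclp_trans by fast
  next
    case 5
    have e: "a \<noteq> b" "b \<noteq> c" "c \<noteq> b'" "b' \<noteq> a" "E c b'" "E b' a" using assms sym irrefl by metis+
    have "{a, b, c, b'} \<in> tsq_cells E" unfolding tsq_cells_def using assms 5 e by blast
    moreover have "cell_loop E {a, b, c, b'} (a # [b, c, b', a])"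
      unfolding cell_loop_def is_walk_iff_walk using assms 5 e by auto
    ultimately have "a # [b, c, b', a] @ b' # c # xs \<simeq> a # b' # c # xs" by (rule htpy_cell)
    moreover have "a # b # c # b' # a # b' # c # xs \<simeq> a # b # c # b' # c # xs"
      using htpy_Cons[OF htpy_Cons[OF htpy_Cons[OF htpy_backtrack[OF e(6)]]]] .
    moreover have "a # b # c # b' # c # xs \<simeq> a # b # c # xs"
      using htpy_Cons[OF htpy_Cons[OF htpy_backtrack[OF e(5)]]] .
    ultimately have "a # b' # c # xs \<simeq> a # b # c # xs"
      using htpy_sym rtranclp_trans by fastforce
    then show ?thesis by (rule htpy_sym)
  qed simp
qed

text \<open>Confluence by induction on the length: the two predecessors \<open>v\<close> and
  \<open>w\<close> of the common end have a common neighbour \<open>x\<close> one step closer to the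
  start. Both tails are homotopic to geodesics through \<open>x\<close>, and a swap exchanges
  \<open>v\<close> for \<open>w\<close>.\<close>

lemma wm_geodesics_htpy:
  assumes "weakly_modular E" "geodesic xs" "geodesic ys" "hd xs = hd ys" "last xs = last ys"
  shows "xs \<simeq> ys"
  using assms(2-)
proof (induction "length xs" arbitrary: xs ys rule: less_induct)
  case less
  define u where "u = last xs"
  have len: "length xs = length ys" using less.prems unfolding geodesic_def by simp
  show ?case
  proof (cases xs rule: walk.cases)
    case (2 a)
    then show ?thesis using len less.prems by (cases ys) auto
  next
    case (3 z v \<alpha>)
    then obtain w \<beta> where ys: "ys = z # w # \<beta>" using len less.prems by (cases ys rule: walk.cases) auto
    have gv: "geodesic (v # \<alpha>)" "last (v # \<alpha>) = u" "gdist E u z = Suc (gdist E u v)"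
      using geodesic_tl[of z v \<alpha>] 3 less.prems u_def by auto
    have gw: "geodesic (w # \<beta>)" "last (w # \<beta>) = u" "gdist E u z = Suc (gdist E u w)"
      using geodesic_tl[of z w \<beta>] ys 3 less.prems u_def by auto
    have e: "E z v" "E z w" "E v z" "E w z" using less.prems 3 ys sym unfolding geodesic_def by auto
    have l: "length (v # \<alpha>) < length xs" "length (w # \<beta>) < length xs" using 3 ys len by auto
    show ?thesis
    proof (cases "v = w")
      case True
      have "v # \<alpha> \<simeq> w # \<beta>" by (rule less.hyps[OF l(1) gv(1) gw(1)]) (use True gv gw in auto)
      then show ?thesis using 3 ys htpy_Cons by blast
    next
      case False
      obtain x m where x: "E x v" "E x w" "gdist E u x = m" "gdist E u v = Suc m"
        using wm_quadrangle[OF assms(1) e(3,4) False, of u "gdist E u v"] gv gw by auto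
      obtain \<xi> where "geodesic \<xi>" "last \<xi> = u" "hd \<xi> = x" using ex_geodesic by blast
      then obtain \<eta> where \<xi>: "geodesic (x # \<eta>)" "last (x # \<eta>) = u"
        using walk_ne unfolding geodesic_def by (cases \<xi>) auto
      have g: "geodesic (v # x # \<eta>)" "geodesic (w # x # \<eta>)"
        using geodesic_Cons[OF \<xi>(1)] x \<xi>(2) gv gw sym by auto
      have 1: "v # \<alpha> \<simeq> v # x # \<eta>" by (rule less.hyps[OF l(1) gv(1) g(1)]) (use gv \<xi> in auto)
      have 2: "w # \<beta> \<simeq> w # x # \<eta>" by (rule less.hyps[OF l(2) gw(1) g(2)]) (use gw \<xi> in auto)
      have "z # v # \<alpha> \<simeq> z # v # x # \<eta>" by (rule htpy_Cons[OF 1])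
      also have "\<dots> \<simeq> z # w # x # \<eta>" using htpy_swap e x sym by blast
      also have "\<dots> \<simeq> z # w # \<beta>" by (rule htpy_Cons[OF htpy_sym[OF 2]])
      finally show ?thesis unfolding 3 ys .
    qed
  qed (use less.prems in \<open>simp add: geodesic_def\<close>)
qed

text \<open>Induction along the walk, whose tail is replaced by a geodesic \<gamma> to
  \<open>v\<close>. The distances of \<open>z\<close> and \<open>v\<close> from \<open>u\<close>
  differ by at most one; accordingly \<open>z # \<gamma>\<close> is itself a geodesic, contains a
  backtrack up to homotopy, or is shortened by a triangle.\<close>

lemma wm_walk_htpy_geodesic:
  assumes "weakly_modular E" "walk xs" "geodesic \<delta>" "hd xs = hd \<delta>" "last xs = last \<delta>"
  shows "xs \<simeq> \<delta>"
  using assms(2-)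
proof (induction xs arbitrary: \<delta> rule: walk.induct)
  case (2 a)
  then have "gdist E (last \<delta>) (hd \<delta>) = 0" using gdist_0 by simp
  then show ?case using 2 by (cases \<delta>) (auto simp: geodesic_def)
next
  case (3 z v xs)
  define u where "u = last \<delta>"
  have e: "E z v" "E v z" using 3 sym by auto
  obtain \<gamma> where \<gamma>: "geodesic \<gamma>" "last \<gamma> = u" "hd \<gamma> = v" using ex_geodesic by blast
  have 1: "z # v # xs \<simeq> z # \<gamma>" using 3 \<gamma> htpy_Cons u_def by auto
  obtain \<gamma>' where \<gamma>': "\<gamma> = v # \<gamma>'" using \<gamma> walk_ne unfolding geodesic_def by (cases \<gamma>) auto
  obtain \<delta>' where \<delta>': "\<delta> = z # \<delta>'" using 3 walk_ne unfolding geodesic_def by (cases \<delta>) auto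
  have lg: "last (v # \<gamma>') = u" and ld: "last (z # \<delta>') = u" using \<gamma> \<gamma>' \<delta>' u_def by auto
  consider "gdist E u z = Suc (gdist E u v)" | "gdist E u v = Suc (gdist E u z)" | "gdist E u z = gdist E u v"
    using gdist_step[OF e(1), of u] gdist_step[OF e(2), of u] by linarith
  then have "z # \<gamma> \<simeq> \<delta>"
  proof cases
    case 1
    have "geodesic (z # \<gamma>)" using geodesic_Cons[of v \<gamma>' z] \<gamma> \<gamma>' e 1 by simp
    then show ?thesis by (rule wm_geodesics_htpy[OF assms(1) _ 3(3)]) (use \<delta>' \<gamma>' lg ld in auto)
  next
    case 2
    have "geodesic (v # \<delta>)" using geodesic_Cons[of z \<delta>' v] 3 \<delta>' e 2 ld by simp
    then have "\<gamma> \<simeq> v # \<delta>" by (rule wm_geodesics_htpy[OF assms(1) \<gamma>(1)]) (use \<delta>' \<gamma>' lg ld in auto)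
    then show ?thesis using rtranclp_trans[OF htpy_Cons[of \<gamma> "v # \<delta>" z]] htpy_backtrack[OF e(1), of \<delta>'] \<delta>' by simp
  next
    case eq: 3
    have "gdist E u v \<noteq> 0" using eq e gdist_0 irrefl by metis
    then obtain n where n: "gdist E u v = Suc n" using not0_implies_Suc by blast
    obtain x where x: "E x z" "E x v" "gdist E u x = n" using wm_triangle[OF assms(1) e(1)] eq n by metis
    obtain \<xi> where "geodesic \<xi>" "last \<xi> = u" "hd \<xi> = x" using ex_geodesic by blast
    then obtain \<eta> where \<xi>: "geodesic (x # \<eta>)" "last (x # \<eta>) = u"
      using walk_ne unfolding geodesic_def by (cases \<xi>) auto
    have g: "geodesic (v # x # \<eta>)" "geodesic (z # x # \<eta>)"
      using geodesic_Cons[OF \<xi>(1)] x \<xi>(2) n eq sym by auto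
    have "\<gamma> \<simeq> v # x # \<eta>" by (rule wm_geodesics_htpy[OF assms(1) \<gamma>(1) g(1)]) (use \<gamma>' lg \<xi> in auto)
    then have "z # \<gamma> \<simeq> z # v # x # \<eta>" by (rule htpy_Cons)
    also have "\<dots> \<simeq> z # x # \<eta>" using htpy_triangle e x sym by blast
    also have "\<dots> \<simeq> \<delta>" by (rule wm_geodesics_htpy[OF assms(1) g(2) 3(3)]) (use \<delta>' ld \<xi> in auto)
    finally show ?thesis .
  qed
  then show ?case by (rule rtranclp_trans[OF 1])
qed simp

lemma wm_simply_connected:
  assumes "weakly_modular E"
  shows "simply_connected E (tsq_cells E)"
  unfolding simply_connected_def
proof (intro conjI allI impI connected)
  fix xs assume a: "is_walk E xs \<and> hd xs = last xs"
  have "gdist E (hd xs) (hd xs) = 0" using gdist_0 by blast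
  then have "geodesic [hd xs]" unfolding geodesic_def by simp
  then show "xs \<simeq> [hd xs]"
    using a by (intro wm_walk_htpy_geodesic[OF assms]) (simp_all add: is_walk_iff_walk)
qed

end

section \<open>Irreducible walks\<close>

text \<open>Local weak modularity in terms of edges only, with base vertex \<open>y\<close>: the
  paths through \<open>a\<close> and \<open>b\<close> express distance two, the last three premises
  of \<open>lqc\<close> distance three. In this form it can be carried along a covering map.\<close>

locale lwm_graph = connected_simple_graph +
  assumes ltc: "\<lbrakk>E v w; y \<noteq> v; \<not> E y v; y \<noteq> w; \<not> E y w; E y a; E a v; E y b; E b w\<rbrakk>
      \<Longrightarrow> \<exists>x. E x y \<and> E x v \<and> E x w"
    and lqc: "\<lbrakk>E z v; E z w; v \<noteq> w; \<not> E v w; y \<noteq> v; \<not> E y v; y \<noteq> w; \<not> E y w;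
      E y a; E a v; E y b; E b w; y \<noteq> z; \<not> E y z; \<forall>c. \<not> (E y c \<and> E c z)\<rbrakk>
      \<Longrightarrow> \<exists>x. E x y \<and> E x v \<and> E x w"
begin

fun reducible :: "'a list \<Rightarrow> bool" where
  "reducible (a # b # c # xs) \<longleftrightarrow> a = c \<or> E a c \<or> reducible (b # c # xs)"
| "reducible _ \<longleftrightarrow> False"

inductive move :: "'a list \<Rightarrow> 'a list \<Rightarrow> bool" where
  here: "\<lbrakk>E a b; E b c; E a b'; E b' c\<rbrakk> \<Longrightarrow> move (a # b # c # xs) (a # b' # c # xs)"
| there: "move xs ys \<Longrightarrow> move (x # xs) (x # ys)"

abbreviation eqv :: "'a list \<Rightarrow> 'a list \<Rightarrow> bool" (infix "\<approx>" 50) where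
  "eqv \<equiv> move\<^sup>*\<^sup>*"

definition irr :: "'a list \<Rightarrow> bool" where
  "irr xs \<longleftrightarrow> walk xs \<and> (\<forall>ys. xs \<approx> ys \<longrightarrow> \<not> reducible ys)"

lemma move_sym: "move xs ys \<Longrightarrow> move ys xs"
  by (induction rule: move.induct) (auto intro: move.intros)

lemma eqv_sym: "xs \<approx> ys \<Longrightarrow> ys \<approx> xs"
  by (metis move_sym sympI symp_rtranclp sympD)

lemma eqv_trans: "xs \<approx> ys \<Longrightarrow> ys \<approx> zs \<Longrightarrow> xs \<approx> zs"
  by simp

lemma eqv_Cons: "xs \<approx> ys \<Longrightarrow> x # xs \<approx> x # ys"
  by (induction rule: rtranclp_induct) (auto intro: rtranclp.rtrancl_into_rtrancl there)

lemma move_swap: "\<lbrakk>E a b; E b c; E a b'; E b' c\<rbrakk> \<Longrightarrow> a # b # c # xs \<approx> a # b' # c # xs"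
  by (blast intro: here)

lemma move_props: "move xs ys \<Longrightarrow> length xs = length ys \<and> hd xs = hd ys \<and> last xs = last ys \<and> xs \<noteq> [] \<and> ys \<noteq> []"
  by (induction rule: move.induct) auto

lemma move_walk: "move xs ys \<Longrightarrow> walk xs \<Longrightarrow> walk ys"
proof (induction rule: move.induct)
  case (there xs ys x)
  then show ?case
    using move_props[OF there.hyps] by (cases xs; cases ys) auto
qed auto

lemma eqv_length: "xs \<approx> ys \<Longrightarrow> length xs = length ys"
  by (induction rule: rtranclp_induct) (auto dest: move_props)

lemma eqv_hd: "xs \<approx> ys \<Longrightarrow> hd xs = hd ys"
  by (induction rule: rtranclp_induct) (auto dest: move_props)

lemma eqv_last: "xs \<approx> ys \<Longrightarrow> last xs = last ys"
  by (induction rule: rtranclp_induct) (auto dest: move_props)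

lemma eqv_walk: "xs \<approx> ys \<Longrightarrow> walk xs \<Longrightarrow> walk ys"
  by (induction rule: rtranclp_induct) (auto dest: move_walk)

lemma eqv_ConsE:
  assumes "v # \<alpha> \<approx> ys"
  obtains \<beta> where "ys = v # \<beta>" "length \<beta> = length \<alpha>"
  using eqv_length[OF assms] eqv_hd[OF assms] by (cases ys) auto

lemma eqv_single: "[x] \<approx> ys \<longleftrightarrow> ys = [x]"
  by (metis eqv_ConsE length_0_conv rtranclp.rtrancl_refl list.size(3))

lemma irr_walk: "irr xs \<Longrightarrow> walk xs"
  by (simp add: irr_def)

lemma irr_eqv: "irr xs \<Longrightarrow> xs \<approx> ys \<Longrightarrow> irr ys"
  unfolding irr_def by (meson eqv_trans eqv_walk)

lemma reducible_Cons: "reducible xs \<Longrightarrow> reducible (x # xs)"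
  by (cases xs rule: reducible.cases) auto

lemma irr_tl: "irr (z # v # \<alpha>) \<Longrightarrow> irr (v # \<alpha>)"
  unfolding irr_def using eqv_Cons reducible_Cons by (metis walk.simps(3))

lemma irr_single: "irr [x]"
  by (simp add: irr_def eqv_single)

lemma irr_edge: "irr (z # v # \<alpha>) \<Longrightarrow> E z v \<and> E v z"
  using irr_walk sym by fastforce

lemma irr2: "irr (a # b # c # \<alpha>) \<Longrightarrow> a \<noteq> c \<and> \<not> E a c \<and> \<not> E c a"
  unfolding irr_def using sym by (metis reducible.simps(1) rtranclp.rtrancl_refl)

text \<open>Irreducibility places \<open>v\<close> at distance two from \<open>y\<close>, and the
  path through \<open>a\<close> does so for \<open>t\<close>, so LTC based at \<open>y\<close>
  applies to the edge \<open>v t\<close>. The resulting \<open>r\<close> may take the place of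
  \<open>s\<close>.\<close>

lemma ltc_swap:
  assumes "irr (v # s # y # \<theta>)" "E v t" "t \<noteq> y" "\<not> E t y" "E t a" "E a y"
  shows "\<exists>r. E r y \<and> E r v \<and> E r t"
  using assms irr2[OF assms(1)] irr_edge[OF assms(1)] irr_edge[OF irr_tl[OF assms(1)]]
    ltc[of v t y s a] sym by blast

text \<open>A common neighbour of \<open>y\<close> and \<open>z\<close> would, by LTC, give a vertex
  that can replace \<open>x\<close> and is adjacent to \<open>z\<close>, and the walk would reduce.
  Thus the ends are at distance three, as LQC requires.\<close>

lemma irr3:
  assumes "irr (z # v # x # y # \<theta>)"
  shows "y \<noteq> z" "\<not> E y z" "\<not> (E y c \<and> E c z)"
proof -
  have w: "E z v" "E v x" "E x y" using irr_walk[OF assms] by auto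
  have no: "\<not> (r = z \<or> E r z)" if "E v r" "E r y" for r
  proof -
    have "z # v # x # y # \<theta> \<approx> z # v # r # y # \<theta>"
      using w that sym by (intro eqv_Cons move_swap) auto
    then show ?thesis using irr2 irr_eqv[OF assms] by blast
  qed
  show 1: "y \<noteq> z" using irr2[OF irr_tl[OF assms]] w sym by blast
  show 2: "\<not> E y z" using no w sym by blast
  show "\<not> (E y c \<and> E c z)"
    using ltc_swap[OF irr_tl[OF assms], of z c] 1 2 w no sym by blast
qed

section \<open>Quadrangle condition for irreducible walks\<close>

text \<open>Meant for the tails of two equivalent walks with the same end: up to moves they continue
  identically after their heads. The first disjunct covers tails that consist of the start
  alone.\<close>

definition shares :: "'a list \<Rightarrow> 'a list \<Rightarrow> bool" where
  "shares \<alpha> \<beta> \<longleftrightarrow> (\<exists>x. \<alpha> = [x] \<and> \<beta> = [x]) \<or>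
     (\<exists>x \<eta>. \<alpha> \<approx> hd \<alpha> # x # \<eta> \<and> \<beta> \<approx> hd \<beta> # x # \<eta>)"

lemma shares_refl: "\<alpha> \<noteq> [] \<Longrightarrow> shares \<alpha> \<alpha>"
  unfolding shares_def by (cases \<alpha> rule: reducible.cases) auto

lemma shares_eqv: "shares \<alpha> \<beta> \<Longrightarrow> \<beta> \<approx> \<gamma> \<Longrightarrow> shares \<alpha> \<gamma>"
  unfolding shares_def by (metis eqv_hd eqv_single eqv_sym eqv_trans)

text \<open>Two nested inductions, on the length and on the sequence of moves. A move inside the
  tail keeps the property; a move at the front turns \<open>v1\<close> into \<open>v2\<close> and
  keeps \<open>x1\<close>. The shorter walks through \<open>x0\<close> and \<open>x1\<close>
  coincide or share some \<open>y\<close> by the outer induction, and local weak modularity at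
  \<open>y\<close> yields a common neighbour of \<open>v0\<close>, \<open>v2\<close> and
  \<open>y\<close>.\<close>

lemma share:
  assumes "irr (z # \<alpha>)" "z # \<alpha> \<approx> z # \<beta>" "\<alpha> \<noteq> []"
  shows "shares \<alpha> \<beta>"
  using assms
proof (induction "length \<alpha>" arbitrary: z \<alpha> \<beta> rule: less_induct)
  case less
  have "shares \<alpha> (tl \<zeta>)" if "z # \<alpha> \<approx> \<zeta>" for \<zeta>
    using that
  proof (induction rule: rtranclp_induct)
    case base
    then show ?case using shares_refl less.prems by simp
  next
    case (step \<xi> \<zeta>)
    from step.hyps(2) show ?case
    proof cases
      case (there xs ys a)
      then show ?thesis using step.IH shares_eqv by auto
    next
      case (here a v1 x1 v2 \<eta>1)
      then have [simp]: "a = z" using eqv_hd[OF step.hyps(1)] by simp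
      obtain v0 \<alpha>' where \<alpha>: "\<alpha> = v0 # \<alpha>'" using less.prems by (cases \<alpha>) auto
      have i1: "irr (z # v1 # x1 # \<eta>1)" using irr_eqv[OF less.prems(1) step.hyps(1)] here by simp
      have len: "length \<alpha> = Suc (Suc (length \<eta>1))" using eqv_length[OF step.hyps(1)] here by simp
      obtain x0 \<eta>0 where s: "\<alpha> \<approx> v0 # x0 # \<eta>0" "v1 # x1 # \<eta>1 \<approx> v1 # x0 # \<eta>0"
        using step.IH here \<alpha> unfolding shares_def by auto
      have i0: "irr (z # v0 # x0 # \<eta>0)" using irr_eqv[OF less.prems(1)] eqv_Cons s(1) by blast
      have "shares (x1 # \<eta>1) (x0 # \<eta>0)"
        using less.hyps[of "x1 # \<eta>1" v1 "x0 # \<eta>0"] len irr_tl[OF i1] s(2) by simp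
      then consider "x1 = x0" "\<eta>1 = \<eta>0" | y \<theta> where "x1 # \<eta>1 \<approx> x1 # y # \<theta>" "x0 # \<eta>0 \<approx> x0 # y # \<theta>"
        unfolding shares_def by auto
      then have "\<exists>x \<eta>. \<alpha> \<approx> v0 # x # \<eta> \<and> v2 # x1 # \<eta>1 \<approx> v2 # x # \<eta>"
      proof cases
        case 1
        then show ?thesis using s(1) by blast
      next
        case 2
        have a: "\<alpha> \<approx> v0 # x0 # y # \<theta>" using s(1) 2(2) eqv_Cons by (meson eqv_trans)
        have b: "v2 # x1 # \<eta>1 \<approx> v2 # x1 # y # \<theta>" using 2(1) eqv_Cons by blast
        have ia: "irr (z # v0 # x0 # y # \<theta>)" using irr_eqv[OF i0] 2(2) eqv_Cons by blast
        have "z # v1 # x1 # \<eta>1 \<approx> z # v2 # x1 # \<eta>1"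
          using here move_swap by simp
        then have ib: "irr (z # v2 # x1 # y # \<theta>)" using irr_eqv[OF i1] b eqv_Cons eqv_trans by blast
        have e: "E z v0" "E v0 x0" "E x0 y" "E z v2" "E v2 x1" "E x1 y"
          using irr_walk[OF ia] irr_walk[OF ib] by auto
        note n = irr2[OF irr_tl[OF ia]] irr2[OF irr_tl[OF ib]] irr3[OF ia]
        \<comment> \<open>If \<open>v0 = v2\<close>, the vertex \<open>x0\<close> serves; if they
          are adjacent, LTC at \<open>y\<close> applies; otherwise \<open>irr3\<close> puts
          \<open>z\<close> at distance three from \<open>y\<close> and LQC applies.\<close>
        consider x where "E x y" "E x v0" "E x v2"
          using ltc[of v0 v2 y x0 x1] lqc[of z v0 v2 y x0 x1] e n sym
          by (cases "v0 = v2"; cases "E v0 v2") metis+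
        then show ?thesis
        proof cases
          case (1 x)
          have "v0 # x0 # y # \<theta> \<approx> v0 # x # y # \<theta>" "v2 # x1 # y # \<theta> \<approx> v2 # x # y # \<theta>"
            using 1 e sym by (auto intro!: move_swap)
          then show ?thesis using a b eqv_trans by blast
        qed
      qed
      then show ?thesis using here \<alpha> unfolding shares_def by auto
    qed
  qed
  from this[OF less.prems(2)] show ?case by simp
qed

lemma shareE:
  assumes "irr (z # v # \<alpha>)" "z # v # \<alpha> \<approx> z # w # \<beta>"
  obtains "v = w" "\<alpha> = []" "\<beta> = []"
  | x \<eta> where "v # \<alpha> \<approx> v # x # \<eta>" "w # \<beta> \<approx> w # x # \<eta>"
  using share[OF assms] unfolding shares_def by auto

section \<open>Prolonging irreducible walks\<close>

text \<open>Prepending \<open>z\<close> creates no reduction at the front, whatever moves are made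
  inside \<alpha>. Moves that exchange the head of \<alpha> are left out here; \<open>extend\<close>
  shows that they do no harm.\<close>

definition good :: "'a \<Rightarrow> 'a list \<Rightarrow> bool" where
  "good z \<alpha> \<longleftrightarrow> (\<forall>x \<eta>. \<alpha> \<approx> hd \<alpha> # x # \<eta> \<longrightarrow> x \<noteq> z \<and> \<not> E x z)"

lemma good_eqv: "good z \<alpha> \<Longrightarrow> \<alpha> \<approx> \<beta> \<Longrightarrow> good z \<beta>"
  unfolding good_def by (metis eqv_hd eqv_trans)

text \<open>The argument of \<open>irr3\<close>, with goodness in place of irreducibility of the
  prolonged walk: a vertex between \<open>v\<close> and \<open>y\<close> that equals
  \<open>z\<close> or is adjacent to it would contradict \<open>good\<close>.\<close>

lemma good_no_reducibleucible:
  assumes "irr (v # x # y # \<theta>)" "good z (v # x # y # \<theta>)" "E z v"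
  shows "y \<noteq> z" "\<not> E y z" "\<not> (E z a \<and> E a y)"
proof -
  have e: "E v x" "E x y" using irr_walk[OF assms(1)] by auto
  have no: "\<not> (r = z \<or> E r z)" if "E v r" "E r y" for r
    using assms(2) e that sym move_swap[of v x y r \<theta>] unfolding good_def by auto
  show 1: "y \<noteq> z" using irr2[OF assms(1)] assms(3) sym by blast
  show 2: "\<not> E y z" using no assms(3) sym by blast
  show "\<not> (E z a \<and> E a y)"
    using ltc_swap[OF assms(1), of z a] 1 2 e no sym assms(3) by blast
qed

text \<open>Along every sequence of moves from \<open>z # \<alpha>\<close> the tail remains
  irreducible, good and attached to \<open>z\<close>, so no reducible walk is reached. The critical
  move exchanges the vertex next to \<open>z\<close>.\<close>

lemma extend:
  assumes "irr \<alpha>" "E z (hd \<alpha>)" "good z \<alpha>"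
  shows "irr (z # \<alpha>)"
  using assms
proof (induction "length \<alpha>" arbitrary: z \<alpha> rule: less_induct)
  case less
  have "\<exists>\<beta>. \<zeta> = z # \<beta> \<and> irr \<beta> \<and> E z (hd \<beta>) \<and> good z \<beta> \<and> length \<beta> = length \<alpha>" if "z # \<alpha> \<approx> \<zeta>" for \<zeta>
    using that
  proof (induction rule: rtranclp_induct)
    case base
    then show ?case using less.prems by simp
  next
    case (step \<xi> \<zeta>)
    then obtain \<beta> where \<beta>: "\<xi> = z # \<beta>" "irr \<beta>" "E z (hd \<beta>)" "good z \<beta>" "length \<beta> = length \<alpha>" by blast
    from step.hyps(2) show ?case
    proof cases
      case (there xs ys a)
      then show ?thesis using \<beta> good_eqv irr_eqv eqv_hd eqv_length by (metis list.inject r_into_rtranclp)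
    next
      case (here a v x v' \<eta>)
      have [simp]: "a = z" and \<beta>': "\<beta> = v # x # \<eta>" using here \<beta> by auto
      have i: "irr (v # x # \<eta>)" and g: "good z (v # x # \<eta>)" using \<beta> \<beta>' by auto
      have e: "E z v" "E v x" "E z v'" "E v' x" using here by auto
      \<comment> \<open>By the induction on the length, a failure means that \<open>v'\<close> is
        not good for \<open>x # \<eta>\<close>: some \<open>y\<close> after \<open>x\<close> equals
        \<open>v'\<close> or is adjacent to it. Then \<open>y\<close> is within distance two of
        \<open>z\<close>, against \<open>good_no_reducibleucible\<close>.\<close>
      have i': "irr (v' # x # \<eta>)"
      proof (rule ccontr)
        assume "\<not> ?thesis"
        then obtain y \<theta> where y: "x # \<eta> \<approx> x # y # \<theta>" "y = v' \<or> E y v'"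
          using less.hyps[of "x # \<eta>" v'] \<beta>(5) \<beta>' irr_tl[OF i] e unfolding good_def by auto
        have "v # x # \<eta> \<approx> v # x # y # \<theta>" using y eqv_Cons by blast
        then show False using good_no_reducibleucible[of v x y \<theta> z] y(2) e irr_eqv[OF i] good_eqv[OF g] sym by blast
      qed
      have "good z (v' # x # \<eta>)"
        unfolding good_def
      proof (intro allI impI)
        fix x1 \<eta>1
        assume a: "v' # x # \<eta> \<approx> hd (v' # x # \<eta>) # x1 # \<eta>1"
        then have a': "v' # x # \<eta> \<approx> v' # x1 # \<eta>1" by simp
        show "x1 \<noteq> z \<and> \<not> E x1 z"
        \<comment> \<open>A continuation \<open>x1\<close> of the new tail is \<open>x\<close>
          itself or shares a vertex \<open>y\<close> with the continuation through \<open>x\<close>;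
          in the latter case \<open>y\<close> is too far from \<open>z\<close> for \<open>x1\<close>
          to be equal or adjacent to \<open>z\<close>.\<close>
        proof (rule shareE[OF i' a'])
          assume "x = x1" then show ?thesis using g unfolding good_def by auto
        next
          fix y \<theta>
          assume y: "x # \<eta> \<approx> x # y # \<theta>" "x1 # \<eta>1 \<approx> x1 # y # \<theta>"
          have 1: "v # x # \<eta> \<approx> v # x # y # \<theta>" using y eqv_Cons by blast
          have "irr (x1 # y # \<theta>)" using irr_tl[OF irr_eqv[OF i' a']] irr_eqv y(2) by blast
          then have "E x1 y" using irr_edge by blast
          then show ?thesis using good_no_reducibleucible[of v x y \<theta> z] e irr_eqv[OF i 1] good_eqv[OF g 1] sym by blast
        qed
      qed
      then show ?thesis using i' here e \<beta>(5) \<beta>' by simp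
    qed
  qed
  moreover have "\<not> reducible (z # \<beta>)" if "irr \<beta>" "good z \<beta>" for \<beta>
  proof (cases \<beta> rule: reducible.cases)
    case (1 a b c xs)
    then show ?thesis using that unfolding good_def irr_def using sym
      by (metis list.sel(1) reducible.simps(1) rtranclp.rtrancl_refl)
  next
    case ("2_3" v vb)
    then show ?thesis using that sym unfolding good_def by auto
  qed auto
  ultimately show ?case
    using less.prems irr_walk[OF less.prems(1)] unfolding irr_def[of "z # \<alpha>"]
    by (cases \<alpha>) auto
qed

text \<open>If \<open>z\<close> is not good for \<open>x # \<eta>\<close>, some continuation
  \<open>p\<close> is adjacent to \<open>z\<close> (\<open>p = z\<close> would reduce the walk
  through \<open>v\<close>), and swapping \<open>x\<close> for \<open>z\<close> puts
  \<open>z\<close> one step below \<open>v\<close>. Otherwise \<open>extend\<close> places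
  \<open>z\<close> at the level of \<open>v\<close>.\<close>

lemma hor_cases:
  assumes "irr (v # x # \<eta>)" "E z v" "E z x"
  shows "irr (z # x # \<eta>) \<or> (\<exists>p \<rho>. x # \<eta> \<approx> x # p # \<rho> \<and> E p z \<and> v # x # \<eta> \<approx> v # z # p # \<rho>)"
proof (rule disjCI)
  assume "\<not> (\<exists>p \<rho>. x # \<eta> \<approx> x # p # \<rho> \<and> E p z \<and> v # x # \<eta> \<approx> v # z # p # \<rho>)"
  moreover have "p \<noteq> z \<and> (E p z \<longrightarrow> v # x # \<eta> \<approx> v # z # p # \<rho>)" if "x # \<eta> \<approx> x # p # \<rho>" for p \<rho>
  proof -
    have 1: "v # x # \<eta> \<approx> v # x # p # \<rho>" using that eqv_Cons by blast
    then have i: "irr (v # x # p # \<rho>)" using assms irr_eqv by blast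
    then have "E p z \<Longrightarrow> v # x # p # \<rho> \<approx> v # z # p # \<rho>"
      using irr_walk[OF i] assms sym by (auto intro!: move_swap)
    then show ?thesis using irr2[OF i] 1 assms by (meson eqv_trans)
  qed
  ultimately have "good z (x # \<eta>)" unfolding good_def by auto
  then show "irr (z # x # \<eta>)" using extend irr_tl[OF assms(1)] assms(3) by simp
qed

section \<open>Adjacency of irreducible walks\<close>

text \<open>Edges of the universal cover, on walks that represent its vertices. No quotient type is
  formed: \<open>adj_eqv\<close> and \<open>adj_eqv2\<close> show that the relation respects
  equivalence on both sides.\<close>

definition adj :: "'a list \<Rightarrow> 'a list \<Rightarrow> bool" where
  "adj \<gamma> \<delta> \<longleftrightarrow> irr \<gamma> \<and> irr \<delta> \<and> E (hd \<gamma>) (hd \<delta>) \<and>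
     (\<delta> \<approx> hd \<delta> # \<gamma> \<or> \<gamma> \<approx> hd \<gamma> # \<delta> \<or> (\<exists>x \<eta>. \<gamma> \<approx> hd \<gamma> # x # \<eta> \<and> \<delta> \<approx> hd \<delta> # x # \<eta>))"

lemma adj_sym: "adj \<gamma> \<delta> \<Longrightarrow> adj \<delta> \<gamma>"
  unfolding adj_def using sym by blast

lemma adj_eqv:
  assumes "adj \<gamma> \<delta>" "\<gamma> \<approx> \<gamma>'"
  shows "adj \<gamma>' \<delta>"
proof -
  have "hd \<gamma>' = hd \<gamma>" "\<gamma>' \<approx> \<gamma>" "irr \<gamma>'" "hd \<delta> # \<gamma> \<approx> hd \<delta> # \<gamma>'"
    using assms eqv_hd eqv_sym irr_eqv eqv_Cons unfolding adj_def by metis+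
  then show ?thesis using assms(1) unfolding adj_def by (metis eqv_trans)
qed

lemma adj_eqv2: "adj \<gamma> \<delta> \<Longrightarrow> \<delta> \<approx> \<delta>' \<Longrightarrow> adj \<gamma> \<delta>'"
  using adj_eqv adj_sym by blast

lemma adj_up: "irr (z # \<gamma>) \<Longrightarrow> \<gamma> \<noteq> [] \<Longrightarrow> adj \<gamma> (z # \<gamma>)"
  unfolding adj_def using irr_tl irr_edge by (cases \<gamma>) auto

lemma adj_hor: "irr (v # x # \<eta>) \<Longrightarrow> irr (w # x # \<eta>) \<Longrightarrow> E v w \<Longrightarrow> adj (v # x # \<eta>) (w # x # \<eta>)"
  unfolding adj_def by auto

lemma irr_ne: "irr \<gamma> \<Longrightarrow> \<gamma> \<noteq> []"
  using irr_walk by fastforce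

lemma adjE [consumes 1, case_names up down hor]:
  assumes "adj \<gamma> \<delta>"
  obtains (up) "irr (hd \<delta> # \<gamma>)" "\<delta> \<approx> hd \<delta> # \<gamma>"
  | (down) "irr (hd \<gamma> # \<delta>)" "\<gamma> \<approx> hd \<gamma> # \<delta>"
  | (hor) x \<eta> where "\<gamma> \<approx> hd \<gamma> # x # \<eta>" "\<delta> \<approx> hd \<delta> # x # \<eta>" "irr (hd \<gamma> # x # \<eta>)" "irr (hd \<delta> # x # \<eta>)"
  using assms irr_eqv unfolding adj_def by metis

text \<open>A good \<open>z\<close> prolongs the walk. Otherwise some representative has
  \<open>z\<close> or a neighbour of \<open>z\<close> just before its end; in the latter case
  \<open>hor_cases\<close> decides between the same level and one step down.\<close>

lemma adj_exists:
  assumes "irr \<gamma>" "E z (hd \<gamma>)"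
  shows "\<exists>\<delta>. hd \<delta> = z \<and> adj \<gamma> \<delta>"
proof (cases "good z \<gamma>")
  case True
  then show ?thesis using extend assms adj_up irr_ne by (metis list.sel(1))
next
  case False
  obtain v \<alpha> where \<gamma>: "\<gamma> = v # \<alpha>" using irr_ne[OF assms(1)] by (cases \<gamma>) auto
  have down: ?thesis if "\<gamma> \<approx> v # z # \<rho>" for \<rho>
  proof -
    have "adj (v # z # \<rho>) (z # \<rho>)" using adj_sym adj_up irr_eqv[OF assms(1) that] by blast
    then show ?thesis using adj_eqv eqv_sym[OF that] by (metis list.sel(1))
  qed
  obtain x \<eta> where x: "\<gamma> \<approx> v # x # \<eta>" "x = z \<or> E x z" using False \<gamma> unfolding good_def by auto
  have i: "irr (v # x # \<eta>)" using x assms irr_eqv by blast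
  show ?thesis
  proof (cases "x = z")
    case True
    then show ?thesis using down x by blast
  next
    case False
    then have xz: "E z x" "E z v" using x sym assms \<gamma> by auto
    from hor_cases[OF i xz(2,1)] show ?thesis
    proof (elim disjE exE conjE)
      assume "irr (z # x # \<eta>)"
      then have "adj (v # x # \<eta>) (z # x # \<eta>)" using adj_hor i xz sym by blast
      then show ?thesis using adj_eqv eqv_sym[OF x(1)] by (metis list.sel(1))
    qed (meson down eqv_trans x(1))
  qed
qed

text \<open>\<open>shareE\<close> together with the irreducibility and the edges that later case
  distinctions draw from it.\<close>

lemma irr_shareE:
  assumes "irr (z # v # \<alpha>)" "irr (z # w # \<beta>)" "\<gamma> \<approx> z # v # \<alpha>" "\<gamma> \<approx> z # w # \<beta>"
  obtains (base) "v = w" "\<alpha> = []" "\<beta> = []"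
  | (step) y \<theta> where "v # \<alpha> \<approx> v # y # \<theta>" "w # \<beta> \<approx> w # y # \<theta>"
      "z # v # \<alpha> \<approx> z # v # y # \<theta>" "z # w # \<beta> \<approx> z # w # y # \<theta>"
      "irr (v # y # \<theta>)" "irr (w # y # \<theta>)" "irr (z # v # y # \<theta>)" "irr (z # w # y # \<theta>)"
      "E z v" "E z w" "E v y" "E w y" "y \<noteq> z" "\<not> E y z" "\<not> E z y"
proof -
  have "z # v # \<alpha> \<approx> z # w # \<beta>" using assms eqv_sym eqv_trans by blast
  then show ?thesis
  proof (rule shareE[OF assms(1)])
    fix y \<theta> assume a: "v # \<alpha> \<approx> v # y # \<theta>" "w # \<beta> \<approx> w # y # \<theta>"
    then have b: "z # v # \<alpha> \<approx> z # v # y # \<theta>" "z # w # \<beta> \<approx> z # w # y # \<theta>" using eqv_Cons by blast+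
    have i: "irr (z # v # y # \<theta>)" "irr (z # w # y # \<theta>)" using b assms irr_eqv by blast+
    show thesis
      using step[OF a b] i irr_tl[OF i(1)] irr_tl[OF i(2)] irr_walk[OF i(1)] irr_walk[OF i(2)] irr2[OF i(1)] by auto
  qed (use base in auto)
qed

text \<open>The three relative levels exclude each other: mixing two of them puts three consecutive
  vertices with equal or adjacent ends into an irreducible walk, or yields a loop. Two downward or
  two horizontal neighbours are compared through \<open>irr_shareE\<close>.\<close>

lemma adj_unique:
  assumes "adj \<gamma> \<delta>" "adj \<gamma> \<delta>'" "hd \<delta> = hd \<delta>'"
  shows "\<delta> \<approx> \<delta>'"
proof -
  obtain v \<alpha> where \<gamma>: "\<gamma> = v # \<alpha>" using assms irr_ne unfolding adj_def by (cases \<gamma>) auto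
  obtain z \<beta> where \<delta>: "\<delta> = z # \<beta>" using assms irr_ne unfolding adj_def by (cases \<delta>) auto
  obtain \<beta>' where \<delta>': "\<delta>' = z # \<beta>'" using assms \<delta> irr_ne unfolding adj_def by (cases \<delta>') auto
  have vz: "E v z" "E z v" using assms \<gamma> \<delta> sym unfolding adj_def by auto
  have up_no_down: "\<not> irr (z # \<gamma>)" if "\<gamma> \<approx> v # z # \<eta>" for \<eta>
    using that eqv_Cons irr_eqv irr2 by blast
  have up_no_hor: "\<not> irr (z # \<gamma>)" if "\<gamma> \<approx> v # x # \<eta>" "irr (z # x # \<eta>)" for x \<eta>
    using that eqv_Cons irr_eqv irr2 irr_edge by blast
  have down_no_hor: False if "\<gamma> \<approx> v # z # \<zeta>" "\<gamma> \<approx> v # x # \<eta>" "irr (z # x # \<eta>)" for x \<eta> \<zeta>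
  proof -
    have i: "irr (v # z # \<zeta>)" "irr (v # x # \<eta>)" using assms irr_eqv that unfolding adj_def by blast+
    show False
    proof (rule irr_shareE[OF i that(1,2)])
      assume "z = x" then show False using irr_edge that(3) irrefl by blast
    next
      fix y \<theta> assume "x # \<eta> \<approx> x # y # \<theta>" "irr (z # y # \<theta>)"
      then show False using that(3) eqv_Cons irr_eqv irr2 irr_edge by meson
    qed
  qed
  from assms(1) show ?thesis
  proof (cases rule: adjE)
    case up
    from assms(2) show ?thesis
    proof (cases rule: adjE)
      case up': up
      then have "\<delta> \<approx> z # \<gamma>" "\<delta>' \<approx> z # \<gamma>" using up \<delta> \<delta>' by auto
      then show ?thesis using eqv_sym eqv_trans by blast
    next
      case down
      then show ?thesis using up(1) up_no_down[of \<beta>'] \<gamma> \<delta> \<delta>' by simp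
    next
      case (hor x \<eta>)
      then show ?thesis using up(1) up_no_hor[of x \<eta>] \<gamma> \<delta> \<delta>' by simp
    qed
  next
    case down
    from assms(2) show ?thesis
    proof (cases rule: adjE)
      case down': down
      have d: "irr (v # z # \<beta>)" "irr (v # z # \<beta>')" "\<gamma> \<approx> v # z # \<beta>" "\<gamma> \<approx> v # z # \<beta>'"
        using down down' \<gamma> \<delta> \<delta>' by auto
      show ?thesis
      proof (rule irr_shareE[OF d])
        fix y \<theta> assume "z # \<beta> \<approx> z # y # \<theta>" "z # \<beta>' \<approx> z # y # \<theta>"
        then show ?thesis using \<delta> \<delta>' eqv_sym eqv_trans by metis
      qed (simp add: \<delta> \<delta>')
    next
      case up
      then show ?thesis using down up_no_down[of \<beta>] \<gamma> \<delta> \<delta>' by simp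
    next
      case (hor x \<eta>)
      then show ?thesis using down down_no_hor[of \<beta> x \<eta>] \<gamma> \<delta> \<delta>' by simp
    qed
  next
    case (hor x \<eta>)
    from assms(2) show ?thesis
    proof (cases rule: adjE)
      case hor': (hor x' \<eta>')
      have d: "irr (v # x # \<eta>)" "irr (v # x' # \<eta>')" "\<gamma> \<approx> v # x # \<eta>" "\<gamma> \<approx> v # x' # \<eta>'"
        "\<delta> \<approx> z # x # \<eta>" "\<delta>' \<approx> z # x' # \<eta>'" "irr (z # x # \<eta>)" "irr (z # x' # \<eta>')"
        using hor hor' \<gamma> \<delta> \<delta>' by auto
      have "z # x # \<eta> \<approx> z # x' # \<eta>'"
      proof (rule irr_shareE[OF d(1-4)])
        fix y \<theta> assume y: "x # \<eta> \<approx> x # y # \<theta>" "x' # \<eta>' \<approx> x' # y # \<theta>" "E x y" "E x' y"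
        have "z # x # y # \<theta> \<approx> z # x' # y # \<theta>"
          using y irr_edge[OF d(7)] irr_edge[OF d(8)] by (intro move_swap) auto
        then show ?thesis using y eqv_Cons eqv_sym eqv_trans by meson
      qed auto
      then show ?thesis using d eqv_sym eqv_trans by meson
    next
      case up
      then show ?thesis using hor up_no_hor[of x \<eta>] \<gamma> \<delta> \<delta>' by simp
    next
      case down
      then show ?thesis using hor down_no_hor[of \<beta>' x \<eta>] \<gamma> \<delta> \<delta>' by simp
    qed
  qed
qed

lemma adj_horI:
  "\<lbrakk>irr \<gamma>; irr \<delta>; \<gamma> \<approx> v # x # \<eta>; \<delta> \<approx> w # x # \<eta>; E v w\<rbrakk> \<Longrightarrow> adj \<gamma> \<delta>"
  unfolding adj_def by (metis eqv_hd list.sel(1))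

lemma adj_upI: "\<lbrakk>irr \<gamma>; irr \<delta>; \<delta> \<approx> z # \<gamma>'; \<gamma> \<approx> \<gamma>'\<rbrakk> \<Longrightarrow> adj \<gamma> \<delta>"
  using adj_up[of z \<gamma>'] irr_eqv[of \<delta> "z # \<gamma>'"] irr_ne[of \<gamma>'] irr_eqv[of \<gamma> \<gamma>']
    adj_eqv[OF _ eqv_sym] adj_eqv2[OF _ eqv_sym] by blast

lemma adj_irr: "adj \<gamma> \<delta> \<Longrightarrow> irr \<gamma> \<and> irr \<delta> \<and> E (hd \<gamma>) (hd \<delta>)"
  unfolding adj_def by blast

section \<open>Lifting of triangles\<close>

text \<open>Here \<delta> is one step above \<gamma>. If \<epsilon> is above too, both have
  predecessor \<open>v\<close>; an \<epsilon> below would make \<open>w, v, z\<close> reducible; for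
  an \<epsilon> at the level of \<gamma>, swapping \<open>v\<close> for \<open>z\<close> shows that
  \<delta> lies above \<epsilon>.\<close>

lemma triangle_up:
  assumes "adj \<gamma> \<delta>" "\<delta> \<approx> hd \<delta> # \<gamma>" "adj \<gamma> \<epsilon>" "E (hd \<delta>) (hd \<epsilon>)"
  shows "adj \<delta> \<epsilon>"
proof -
  obtain v \<alpha> where \<gamma>: "\<gamma> = v # \<alpha>" using assms irr_ne unfolding adj_def by (cases \<gamma>) auto
  define w z where wz: "w = hd \<delta>" "z = hd \<epsilon>"
  have i: "irr \<gamma>" "irr \<delta>" "irr \<epsilon>" using assms adj_irr by auto
  have e: "E v w" "E w v" "E v z" "E z v" "E w z" "E z w"
    using assms adj_irr \<gamma> wz sym by (metis list.sel(1))+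
  have \<delta>: "\<delta> \<approx> w # \<gamma>" using assms wz by simp
  from assms(3) show ?thesis
  proof (cases rule: adjE)
    case up
    then show ?thesis using adj_horI[OF i(2,3), of w v \<alpha> z] \<delta> \<gamma> wz e by auto
  next
    case down
    then have "\<gamma> \<approx> v # \<epsilon>" using \<gamma> by simp
    then have "\<delta> \<approx> w # v # \<epsilon>" using \<delta> eqv_Cons eqv_trans by blast
    moreover obtain \<beta> where "\<epsilon> = z # \<beta>" using wz irr_ne[OF i(3)] by (cases \<epsilon>) auto
    ultimately show ?thesis using i irr_eqv irr2 e by blast
  next
    case (hor x \<eta>)
    then have h: "\<gamma> \<approx> v # x # \<eta>" "\<epsilon> \<approx> z # x # \<eta>" using \<gamma> wz by auto
    have "\<delta> \<approx> w # v # x # \<eta>" using \<delta> h eqv_Cons eqv_trans by blast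
    moreover have "w # v # x # \<eta> \<approx> w # z # x # \<eta>"
      using h i e irr_eqv irr_edge by (intro move_swap) blast+
    ultimately show ?thesis using adj_upI[OF i(3,2), of w "z # x # \<eta>"] h(2) adj_sym eqv_trans by blast
  qed
qed

lemma triangle_hor:
  assumes "adj \<gamma> \<delta>" "\<gamma> \<approx> hd \<gamma> # x # \<eta>" "\<delta> \<approx> hd \<delta> # x # \<eta>" "adj \<gamma> \<epsilon>" "E (hd \<delta>) (hd \<epsilon>)"
  shows "adj \<delta> \<epsilon>"
proof -
  define v w z where vwz: "v = hd \<gamma>" "w = hd \<delta>" "z = hd \<epsilon>"
  have i: "irr \<gamma>" "irr \<delta>" "irr \<epsilon>" using assms adj_irr by auto
  have e: "E v w" "E w v" "E v z" "E z v" "E w z" "E z w"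
    using assms adj_irr vwz sym by metis+
  have h: "\<gamma> \<approx> v # x # \<eta>" "\<delta> \<approx> w # x # \<eta>" using assms vwz by auto
  have hi: "irr (v # x # \<eta>)" "irr (w # x # \<eta>)" using h i irr_eqv by blast+
  from assms(4) show ?thesis
  proof (cases rule: adjE)
    case up
    then show ?thesis using triangle_up[OF assms(4) _ assms(1)] assms(5) sym adj_sym by blast
  next
    case down
    obtain \<zeta> where \<epsilon>: "\<epsilon> = z # \<zeta>" using irr_ne[OF i(3)] vwz by (cases \<epsilon>) auto
    then have d: "\<gamma> \<approx> v # z # \<zeta>" "irr (v # z # \<zeta>)" using down vwz by auto
    show ?thesis
    proof (rule irr_shareE[OF hi(1) d(2) h(1) d(1)])
      assume "x = z" "\<eta> = []" "\<zeta> = []"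
      then show ?thesis using adj_upI[OF i(3,2), of w \<epsilon>] h(2) \<epsilon> adj_sym by auto
    next
      fix y \<theta> assume y: "x # \<eta> \<approx> x # y # \<theta>" "z # \<zeta> \<approx> z # y # \<theta>" "E x y" "E z y"
      have "w # x # \<eta> \<approx> w # x # y # \<theta>" using y eqv_Cons by blast
      also have "\<dots> \<approx> w # z # y # \<theta>" using y e irr_edge[OF hi(2)] by (intro move_swap) auto
      finally show ?thesis using adj_upI[OF i(3,2), of w "z # y # \<theta>"] h(2) \<epsilon> y(2) adj_sym eqv_trans by blast
    qed
  next
    case (hor x' \<eta>')
    then have h': "\<gamma> \<approx> v # x' # \<eta>'" "\<epsilon> \<approx> z # x' # \<eta>'" "irr (v # x' # \<eta>')" "irr (z # x' # \<eta>')" using vwz by auto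
    show ?thesis
    proof (rule irr_shareE[OF hi(1) h'(3) h(1) h'(1)])
      assume "x = x'" "\<eta> = []" "\<eta>' = []"
      then show ?thesis using adj_horI[OF i(2,3)] h(2) h'(2) e by blast
    next
      fix y \<theta> assume y: "x # \<eta> \<approx> x # y # \<theta>" "x' # \<eta>' \<approx> x' # y # \<theta>" "E x y" "E x' y"
      have w: "w # x # \<eta> \<approx> w # x # y # \<theta>" using y eqv_Cons by blast
      have z: "z # x' # \<eta>' \<approx> z # x' # y # \<theta>" using y eqv_Cons by blast
      have iw: "irr (w # x # y # \<theta>)" and iz: "irr (z # x' # y # \<theta>)" using w z hi h' irr_eqv by blast+
      \<comment> \<open>Both \<delta> and \<epsilon> are two steps above \<open>y\<close>; LTC at
        \<open>y\<close> for the edge \<open>w z\<close> gives a single predecessor \<open>r\<close>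
        that serves both.\<close>
      obtain r where r: "E r y" "E r w" "E r z"
        using ltc_swap[OF iw, of z x'] e irr2[OF iz] irr_edge[OF iz] y by blast
      have "w # x # y # \<theta> \<approx> w # r # y # \<theta>" "z # x' # y # \<theta> \<approx> z # r # y # \<theta>"
        using r y irr_edge[OF iw] irr_edge[OF iz] sym by (auto intro!: move_swap)
      then show ?thesis using adj_horI[OF i(2,3), of w r "y # \<theta>" z] h(2) h'(2) w z e eqv_trans by meson
    qed
  qed
qed

text \<open>If \<delta> or \<epsilon> is not below \<gamma>, the two preceding lemmas apply, with
  roles exchanged if necessary. If both are below, \<open>irr_shareE\<close> gives them a common
  predecessor.\<close>

lemma triangle:
  assumes "adj \<gamma> \<delta>" "adj \<gamma> \<epsilon>" "E (hd \<delta>) (hd \<epsilon>)"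
  shows "adj \<delta> \<epsilon>"
  using assms(1)
proof (cases rule: adjE)
  case up
  then show ?thesis using triangle_up assms by blast
next
  case (hor x \<eta>)
  then show ?thesis using triangle_hor assms by blast
next
  case down1: down
  from assms(2) show ?thesis
  proof (cases rule: adjE)
    case up
    then show ?thesis using triangle_up assms sym adj_sym by blast
  next
    case (hor x \<eta>)
    then show ?thesis using triangle_hor assms sym adj_sym by blast
  next
    case down
    have i: "irr \<delta>" "irr \<epsilon>" using assms adj_irr by auto
    obtain w \<alpha> z \<beta> where d: "\<delta> = w # \<alpha>" "\<epsilon> = z # \<beta>" using irr_ne[OF i(1)] irr_ne[OF i(2)] by (cases \<delta>; cases \<epsilon>) auto
    note d1 = down1[unfolded d] and d2 = down[unfolded d]
    show ?thesis
    proof (rule irr_shareE[OF d1(1) d2(1) d1(2) d2(2)])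
      assume "w = z" then show ?thesis using assms(3) d irrefl by simp
    next
      fix y \<theta> assume "w # \<alpha> \<approx> w # y # \<theta>" "z # \<beta> \<approx> z # y # \<theta>"
      then show ?thesis using adj_horI[OF i] d assms(3) by simp
    qed
  qed
qed

section \<open>Lifting of squares\<close>

text \<open>A fourth corner over \<open>t\<close> for a square in which \<gamma> and \<epsilon> are
  opposite corners. The lemmas below treat their possible levels relative to the remaining
  corner.\<close>

definition closes :: "'a list \<Rightarrow> 'a list \<Rightarrow> 'a \<Rightarrow> bool" where
  "closes \<gamma> \<epsilon> t \<longleftrightarrow> (\<exists>\<tau>. hd \<tau> = t \<and> adj \<gamma> \<tau> \<and> adj \<epsilon> \<tau>)"

lemma closesI: "adj \<gamma> (t # \<tau>) \<Longrightarrow> adj \<epsilon> (t # \<tau>) \<Longrightarrow> closes \<gamma> \<epsilon> t"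
  unfolding closes_def by force

lemma closes_sym: "closes \<gamma> \<epsilon> t \<Longrightarrow> closes \<epsilon> \<gamma> t"
  unfolding closes_def by blast

lemma closes_eqv: "closes \<gamma>' \<epsilon>' t \<Longrightarrow> \<gamma> \<approx> \<gamma>' \<Longrightarrow> \<epsilon> \<approx> \<epsilon>' \<Longrightarrow> closes \<gamma> \<epsilon> t"
  unfolding closes_def using adj_eqv eqv_sym by blast

text \<open>Lift \<open>t\<close> to a neighbour \<tau> of the first walk and compare it with the
  second at each level of \<tau>: above, by swapping \<open>v\<close> for \<open>z\<close>; level,
  by LTC at a shared vertex \<open>b\<close>; below, by swapping \<open>s\<close> for
  \<open>t\<close>.\<close>

lemma square_same_level:
  assumes "irr (v # s # \<mu>)" "irr (z # s # \<mu>)" "E t v" "E t z"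
  shows "closes (v # s # \<mu>) (z # s # \<mu>) t"
proof -
  obtain \<tau> where \<tau>: "hd \<tau> = t" "adj (v # s # \<mu>) \<tau>"
    using adj_exists[OF assms(1), of t] assms by auto
  have i: "irr \<tau>" using \<tau> adj_irr by auto
  have e: "E v s" "E z s" "E v t" "E z t" using assms irr_edge sym by blast+
  from \<tau>(2) have "adj (z # s # \<mu>) \<tau>"
  proof (cases rule: adjE)
    case up
    then have "\<tau> \<approx> t # v # s # \<mu>" using \<tau> by simp
    also have "\<dots> \<approx> t # z # s # \<mu>" using e assms by (intro move_swap) auto
    finally show ?thesis using adj_upI[OF assms(2) i] by blast
  next
    case (hor a \<rho>)
    then have h: "v # s # \<mu> \<approx> v # a # \<rho>" "\<tau> \<approx> t # a # \<rho>" "irr (v # a # \<rho>)" "irr (t # a # \<rho>)" using \<tau> by auto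
    show ?thesis
    proof (rule irr_shareE[OF assms(1) h(3) _ h(1)])
      assume "s = a" "\<mu> = []" "\<rho> = []"
      then show ?thesis using adj_horI[OF assms(2) i] e h(2) by blast
    next
      fix b \<kappa> assume b: "s # \<mu> \<approx> s # b # \<kappa>" "a # \<rho> \<approx> a # b # \<kappa>" "E s b" "E a b"
      have tz: "t # a # \<rho> \<approx> t # a # b # \<kappa>" "z # s # \<mu> \<approx> z # s # b # \<kappa>" using b eqv_Cons by blast+
      have it: "irr (t # a # b # \<kappa>)" and iz: "irr (z # s # b # \<kappa>)" using tz assms h irr_eqv by blast+
      obtain r where r: "E r b" "E r t" "E r z"
        using ltc_swap[OF it, of z s] e assms irr2[OF iz] irr_edge[OF iz] b by blast
      have "t # a # b # \<kappa> \<approx> t # r # b # \<kappa>" "z # s # b # \<kappa> \<approx> z # r # b # \<kappa>"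
        using r b irr_edge[OF it] irr_edge[OF iz] sym by (auto intro!: move_swap)
      then show ?thesis using adj_horI[OF assms(2) i, of z r "b # \<kappa>" t] h(2) tz e eqv_trans by meson
    qed simp
  next
    case down
    obtain \<rho> where "\<tau> = t # \<rho>" using irr_ne[OF i] \<tau> by (cases \<tau>) auto
    then have d: "v # s # \<mu> \<approx> v # t # \<rho>" "irr (v # t # \<rho>)" using down by auto
    show ?thesis
    proof (rule irr_shareE[OF assms(1) d(2) _ d(1)])
      assume "s = t" "\<mu> = []" "\<rho> = []"
      then show ?thesis using adj_sym adj_up[OF assms(2)] \<open>\<tau> = t # \<rho>\<close> by auto
    next
      fix b \<kappa> assume b: "s # \<mu> \<approx> s # b # \<kappa>" "t # \<rho> \<approx> t # b # \<kappa>" "E s b" "E t b"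
      have "z # s # \<mu> \<approx> z # s # b # \<kappa>" using b eqv_Cons by blast
      also have "\<dots> \<approx> z # t # b # \<kappa>" using b e by (intro move_swap) auto
      finally show ?thesis using adj_upI[OF i assms(2), of z "t # b # \<kappa>"] b \<open>\<tau> = t # \<rho>\<close> adj_sym by simp
    qed simp
  qed
  then show ?thesis using \<tau> unfolding closes_def by blast
qed

text \<open>If \<open>t\<close> is adjacent to \<open>y\<close>, then
  \<open>t # y # \<theta>\<close> closes the square. Otherwise LTC at \<open>y\<close>, with
  \<open>z\<close> between \<open>t\<close> and \<open>y\<close>, gives an \<open>s'\<close> that
  can replace \<open>s\<close> and is adjacent to \<open>t\<close>; \<open>hor_cases\<close> then
  tells whether \<open>t\<close> lies at the level of \<open>v\<close> or one step below.\<close>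

lemma square_next_level:
  assumes "irr (v # s # y # \<theta>)" "irr (z # y # \<theta>)" "E t v" "E t z"
  shows "closes (v # s # y # \<theta>) (z # y # \<theta>) t"
proof -
  have e: "E v s" "E s y" "E z y" "E v t" "E z t" using assms(3,4) irr_walk[OF assms(1)] irr_walk[OF assms(2)] sym by auto
  have ty: "t \<noteq> y" using irr2[OF assms(1)] e by blast
  show ?thesis
  proof (cases "E t y")
    case True
    then have m: "v # s # y # \<theta> \<approx> v # t # y # \<theta>" using e by (intro move_swap) auto
    then have i: "irr (t # y # \<theta>)" using assms(1) irr_eqv irr_tl by blast
    have "adj (v # s # y # \<theta>) (t # y # \<theta>)" using adj_upI[OF i assms(1) m] adj_sym by blast
    moreover have "adj (z # y # \<theta>) (t # y # \<theta>)" using adj_hor[OF assms(2) i] e by blast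
    ultimately show ?thesis by (blast intro: closesI)
  next
    case False
    obtain s' where s': "E s' y" "E s' v" "E s' t"
      using ltc_swap[OF assms(1), of t z] e assms ty False by blast
    have m: "v # s # y # \<theta> \<approx> v # s' # y # \<theta>" using s' e sym by (intro move_swap) auto
    have i': "irr (v # s' # y # \<theta>)" using m assms(1) irr_eqv by blast
    have "irr (t # s' # y # \<theta>) \<or> (\<exists>p \<rho>. s' # y # \<theta> \<approx> s' # p # \<rho> \<and> E p t \<and> v # s' # y # \<theta> \<approx> v # t # p # \<rho>)"
      using hor_cases[OF i'] assms(3) s' sym by blast
    then show ?thesis
    proof (elim disjE exE conjE)
      assume i: "irr (t # s' # y # \<theta>)"
      have "t # s' # y # \<theta> \<approx> t # z # y # \<theta>" using s' e assms(4) sym by (intro move_swap) auto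
      then have "adj (z # y # \<theta>) (t # s' # y # \<theta>)" using adj_upI[OF assms(2) i] by blast
      moreover have "adj (v # s # y # \<theta>) (t # s' # y # \<theta>)" using adj_horI[OF assms(1) i m] e by blast
      ultimately show ?thesis by (blast intro: closesI)
    next
      fix p \<rho> assume p: "s' # y # \<theta> \<approx> s' # p # \<rho>" "E p t" "v # s' # y # \<theta> \<approx> v # t # p # \<rho>"
      have i: "irr (t # p # \<rho>)" using p irr_eqv[OF i'] irr_tl by blast
      have is': "irr (s' # y # \<theta>)" "irr (s' # p # \<rho>)" using i' p irr_eqv irr_tl by blast+
      have a: "adj (v # s # y # \<theta>) (t # p # \<rho>)"
        using adj_upI[OF i assms(1), of v "t # p # \<rho>"] p(3) m adj_sym eqv_trans by blast
      have "adj (z # y # \<theta>) (t # p # \<rho>)"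
      proof (rule irr_shareE[OF is' _ p(1)])
        assume "y = p" then show ?thesis using p False sym by blast
      next
        fix q \<sigma> assume q: "y # \<theta> \<approx> y # q # \<sigma>" "p # \<rho> \<approx> p # q # \<sigma>" "E y q" "E p q"
        have tz: "z # y # \<theta> \<approx> z # y # q # \<sigma>" "t # p # \<rho> \<approx> t # p # q # \<sigma>" using q eqv_Cons by blast+
        have it: "irr (t # p # q # \<sigma>)" and iz: "irr (z # y # q # \<sigma>)" using tz assms i irr_eqv by blast+
        obtain r where r: "E r q" "E r t" "E r z"
          using ltc_swap[OF it, of z y] e assms irr2[OF iz] q by blast
        have "t # p # q # \<sigma> \<approx> t # r # q # \<sigma>" "z # y # q # \<sigma> \<approx> z # r # q # \<sigma>"
          using r q e irr_edge[OF it] sym by (auto intro!: move_swap)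
        then show ?thesis using adj_horI[OF assms(2) i, of z r "q # \<sigma>" t] tz e eqv_trans by meson
      qed simp
      then show ?thesis by (rule closesI[OF a])
    qed
  qed
qed

text \<open>Split by the distance of \<open>t\<close> from \<open>y\<close>. At distance one,
  \<open>t\<close> can replace both \<open>x\<close> and \<open>x'\<close>. At distance three, LQC
  gives a common predecessor of \<open>v\<close> and \<open>z\<close>, which leads to
  \<open>square_same_level\<close>. At distance two, LTC at \<open>y\<close> gives predecessors
  \<open>s\<close> and \<open>s'\<close> adjacent to \<open>t\<close>, and \<open>hor_cases\<close>
  finds the level of \<open>t\<close>.\<close>

lemma square_two_levels:
  assumes "irr (v # x # y # \<theta>)" "irr (z # x' # y # \<theta>)" "E t v" "E t z" "v \<noteq> z" "\<not> E v z"
  shows "closes (v # x # y # \<theta>) (z # x' # y # \<theta>) t"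
proof -
  have e: "E v x" "E x y" "E z x'" "E x' y" "E v t" "E z t"
    using assms(3,4) irr_walk[OF assms(1)] irr_walk[OF assms(2)] sym by auto
  note nv = irr2[OF assms(1)] and nz = irr2[OF assms(2)]
  have ty: "t \<noteq> y" using nv e by blast
  show ?thesis
  proof (cases "E t y")
    case True
    have m: "v # x # y # \<theta> \<approx> v # t # y # \<theta>" "z # x' # y # \<theta> \<approx> z # t # y # \<theta>"
      using e True by (auto intro!: move_swap)
    then have i: "irr (t # y # \<theta>)" using assms(1) irr_eqv irr_tl by blast
    show ?thesis
      by (rule closesI[OF adj_sym[OF adj_upI[OF i assms(1) m(1)]] adj_sym[OF adj_upI[OF i assms(2) m(2)]]]) auto
  next
    case nty: False
    then have nty': "\<not> E y t" using sym by blast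
    show ?thesis
    proof (cases "\<exists>c. E y c \<and> E c t")
      case False
      obtain s where s: "E s y" "E s v" "E s z"
        using lqc[of t v z y x x'] False assms(3-6) nv nz nty ty e(2,4) sym[OF e(1)] sym[OF e(2)] sym[OF e(3)] sym[OF e(4)] nty' by blast
      have m: "v # x # y # \<theta> \<approx> v # s # y # \<theta>" "z # x' # y # \<theta> \<approx> z # s # y # \<theta>"
        using e s sym by (auto intro!: move_swap)
      have "closes (v # s # y # \<theta>) (z # s # y # \<theta>) t"
        using square_same_level[OF irr_eqv[OF assms(1) m(1)] irr_eqv[OF assms(2) m(2)] assms(3,4)]
        by blast
      then show ?thesis by (rule closes_eqv) (use m in auto)
    next
      case True
      then obtain c where c: "E t c" "E c y" using sym by blast
      obtain s where s: "E s y" "E s v" "E s t"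
        using ltc_swap[OF assms(1) e(5) ty nty c] by blast
      obtain s' where s': "E s' y" "E s' z" "E s' t"
        using ltc_swap[OF assms(2) e(6) ty nty c] by blast
      have m: "v # x # y # \<theta> \<approx> v # s # y # \<theta>" "z # x' # y # \<theta> \<approx> z # s' # y # \<theta>"
        using e s s' sym by (auto intro!: move_swap)
      have iv: "irr (v # s # y # \<theta>)" and iz: "irr (z # s' # y # \<theta>)" using m assms irr_eqv by blast+
      have "irr (t # s # y # \<theta>) \<or> (\<exists>p \<rho>. s # y # \<theta> \<approx> s # p # \<rho> \<and> E p t \<and> v # s # y # \<theta> \<approx> v # t # p # \<rho>)"
        using hor_cases[OF iv] assms(3) s sym by blast
      then have "closes (v # s # y # \<theta>) (z # s' # y # \<theta>) t"
      proof (elim disjE exE conjE)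
        assume i: "irr (t # s # y # \<theta>)"
        have "t # s # y # \<theta> \<approx> t # s' # y # \<theta>" using s s' sym by (intro move_swap) auto
        then show ?thesis using closesI[OF adj_hor[OF iv i e(5)] adj_horI[OF iz i _ _ e(6)]] by blast
      next
        fix p \<rho> assume p: "s # y # \<theta> \<approx> s # p # \<rho>" "E p t" "v # s # y # \<theta> \<approx> v # t # p # \<rho>"
        have i: "irr (t # p # \<rho>)" using p irr_eqv[OF iv] irr_tl by blast
        have is': "irr (s # y # \<theta>)" "irr (s # p # \<rho>)" using iv p irr_eqv irr_tl by blast+
        have a: "adj (v # s # y # \<theta>) (t # p # \<rho>)"
          using adj_upI[OF i iv p(3)] adj_sym by blast
        have "adj (z # s' # y # \<theta>) (t # p # \<rho>)"
        proof (rule irr_shareE[OF is' _ p(1)])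
          assume "y = p" then show ?thesis using p nty sym by blast
        next
          fix q \<sigma> assume q: "y # \<theta> \<approx> y # q # \<sigma>" "p # \<rho> \<approx> p # q # \<sigma>" "E y q" "E p q"
          have t: "t # p # \<rho> \<approx> t # p # q # \<sigma>" and z: "z # s' # y # \<theta> \<approx> z # s' # y # q # \<sigma>"
            using q eqv_Cons by blast+
          have it: "irr (t # p # q # \<sigma>)" and iz': "irr (z # s' # y # q # \<sigma>)" using t z i iz irr_eqv by blast+
          \<comment> \<open>LTC at \<open>q\<close> for the edge \<open>s' t\<close>. Moving
            \<open>y\<close> to \<open>r\<close> and then \<open>s'\<close> to \<open>t\<close>
            brings \<open>t\<close> directly below \<open>z\<close>.\<close>
          obtain r where r: "E r q" "E r s'" "E r t"
            using ltc_swap[OF irr_tl[OF iz'], of t p] s' irr2[OF it] irr_edge[OF it] q by blast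
          have "z # s' # y # q # \<sigma> \<approx> z # s' # r # q # \<sigma>" using r q s' sym by (intro eqv_Cons move_swap) auto
          also have "\<dots> \<approx> z # t # r # q # \<sigma>" using r s' e sym by (intro move_swap) auto
          finally have "z # s' # y # \<theta> \<approx> z # t # r # q # \<sigma>" using z by simp
          moreover have "t # p # q # \<sigma> \<approx> t # r # q # \<sigma>" using r q irr_edge[OF it] sym by (intro move_swap) auto
          ultimately show ?thesis using adj_upI[OF i iz, of z "t # r # q # \<sigma>"] eqv_trans[OF t] adj_sym by blast
        qed simp
        then show ?thesis by (rule closesI[OF a])
      qed
      then show ?thesis by (rule closes_eqv) (use m in auto)
    qed
  qed
qed

text \<open>The level of \<epsilon> relative to \<delta> decides: above leads to
  \<open>square_same_level\<close>, equal to \<open>square_next_level\<close>. If \<epsilon> is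
  below, then \<gamma> is two steps above \<epsilon>, and swapping the middle vertex for
  \<open>t\<close> makes \<open>t # \<epsilon>\<close> the fourth corner.\<close>

lemma square_up:
  assumes "adj \<delta> \<gamma>" "\<gamma> \<approx> hd \<gamma> # \<delta>" "adj \<delta> \<epsilon>" "E t (hd \<gamma>)" "E t (hd \<epsilon>)"
  shows "closes \<gamma> \<epsilon> t"
proof -
  have i: "irr \<delta>" "irr \<gamma>" "irr \<epsilon>" using assms adj_irr by auto
  obtain w \<alpha> where \<delta>: "\<delta> = w # \<alpha>" using irr_ne[OF i(1)] by (cases \<delta>) auto
  define v z where vz: "v = hd \<gamma>" "z = hd \<epsilon>"
  have e: "E t v" "E t z" "E v t" "E z t" using assms vz sym by auto
  have \<gamma>: "\<gamma> \<approx> v # w # \<alpha>" using assms \<delta> vz by simp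
  then have iv: "irr (v # w # \<alpha>)" using i irr_eqv by blast
  from assms(3) show ?thesis
  proof (cases rule: adjE)
    case up
    then have "\<epsilon> \<approx> z # w # \<alpha>" "irr (z # w # \<alpha>)" using vz \<delta> by auto
    then show ?thesis using closes_eqv[OF square_same_level[OF iv _ e(1,2)] \<gamma>] by blast
  next
    case (hor x \<eta>)
    then have h: "\<epsilon> \<approx> z # x # \<eta>" "irr (z # x # \<eta>)" "\<delta> \<approx> w # x # \<eta>" using vz \<delta> by auto
    have m: "\<gamma> \<approx> v # w # x # \<eta>" using eqv_trans[OF \<gamma>] eqv_Cons h(3) \<delta> by blast
    have "closes (v # w # x # \<eta>) (z # x # \<eta>) t"
      using square_next_level[OF irr_eqv[OF i(2) m] h(2) e(1,2)] by blast
    then show ?thesis by (rule closes_eqv) (use m h in auto)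
  next
    case down
    obtain \<zeta> where z: "\<epsilon> = z # \<zeta>" using irr_ne[OF i(3)] vz by (cases \<epsilon>) auto
    then have d: "\<delta> \<approx> w # z # \<zeta>" using down \<delta> by simp
    have m: "\<gamma> \<approx> v # w # z # \<zeta>" using eqv_trans[OF \<gamma>] eqv_Cons d \<delta> by blast
    also have "\<dots> \<approx> v # t # z # \<zeta>"
      using e irr_walk[OF irr_eqv[OF i(2) m]] by (intro move_swap) auto
    finally have m': "\<gamma> \<approx> v # t # \<epsilon>" using z by simp
    then have it: "irr (t # \<epsilon>)" using i irr_eqv irr_tl by blast
    show ?thesis
      by (rule closesI[OF adj_sym[OF adj_upI[OF it i(2) m']] adj_up[OF it irr_ne[OF i(3)]]]) simp
  qed
qed

lemma square_induced:
  assumes "adj \<delta> \<gamma>" "adj \<delta> \<epsilon>" "E t (hd \<gamma>)" "E t (hd \<epsilon>)"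
    and "hd \<gamma> \<noteq> hd \<epsilon>" "\<not> E (hd \<gamma>) (hd \<epsilon>)" "hd \<delta> \<noteq> t" "\<not> E (hd \<delta>) t"
  shows "closes \<gamma> \<epsilon> t"
proof -
  have i: "irr \<delta>" "irr \<gamma>" "irr \<epsilon>" using assms adj_irr by auto
  \<comment> \<open>The mixed case without an upward edge, stated for arbitrary \<gamma> and
    \<epsilon> because it is used in both orders.\<close>
  have hor_down: "closes \<gamma> \<epsilon> t"
    if a: "irr \<gamma>" "irr \<epsilon>" "E t (hd \<gamma>)" "E t (hd \<epsilon>)" "\<not> E (hd \<gamma>) (hd \<epsilon>)"
      "irr (hd \<delta> # x # \<eta>)" "\<delta> \<approx> hd \<delta> # x # \<eta>" "\<gamma> \<approx> hd \<gamma> # x # \<eta>"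
      "irr (hd \<delta> # \<epsilon>)" "\<delta> \<approx> hd \<delta> # \<epsilon>" for \<gamma> \<epsilon> x \<eta>
  proof -
    define v w z where vwz: "v = hd \<gamma>" "w = hd \<delta>" "z = hd \<epsilon>"
    obtain \<zeta> where \<epsilon>: "\<epsilon> = z # \<zeta>" using irr_ne[OF a(2)] vwz(3) by (cases \<epsilon>) auto
    have \<gamma>: "\<gamma> \<approx> v # x # \<eta>" "irr (v # x # \<eta>)" using a(8) irr_eqv[OF a(1,8)] vwz by auto
    have d: "irr (w # x # \<eta>)" "irr (w # z # \<zeta>)" "\<delta> \<approx> w # x # \<eta>" "\<delta> \<approx> w # z # \<zeta>"
      using a(6,7,9,10) vwz(2) \<epsilon> by simp_all
    show ?thesis
    proof (rule irr_shareE[OF d])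
      assume "x = z" then show ?thesis using a(5) vwz irr_edge[OF \<gamma>(2)] by simp
    next
      fix y \<theta> assume y: "x # \<eta> \<approx> x # y # \<theta>" "z # \<zeta> \<approx> z # y # \<theta>" "irr (z # y # \<theta>)"
      have m: "\<gamma> \<approx> v # x # y # \<theta>" by (rule eqv_trans[OF \<gamma>(1) eqv_Cons[OF y(1)]])
      have "closes (v # x # y # \<theta>) (z # y # \<theta>) t"
        using square_next_level[OF irr_eqv[OF a(1) m] y(3)] a(3,4) vwz by simp
      then show ?thesis by (rule closes_eqv) (use m y \<epsilon> in auto)
    qed
  qed
  show ?thesis
    using assms(1)
  proof (cases rule: adjE)
    case up
    show ?thesis by (rule square_up[OF assms(1) up(2) assms(2-4)])
  next
    case down1: down
    from assms(2) show ?thesis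
    proof (cases rule: adjE)
      case up
      show ?thesis by (rule closes_sym[OF square_up[OF assms(2) up(2) assms(1,4,3)]])
    next
      case (hor x \<eta>)
      have "\<not> E (hd \<epsilon>) (hd \<gamma>)" using sym assms(6) by blast
      then show ?thesis by (rule closes_sym[OF hor_down[OF i(3,2) assms(4,3) _ hor(3,1,2) down1]])
    next
      case down
      obtain v \<alpha> z \<beta> where d: "\<gamma> = v # \<alpha>" "\<epsilon> = z # \<beta>" using irr_ne[OF i(2)] irr_ne[OF i(3)] by (meson list.exhaust)
      note d1 = down1[unfolded d] and d2 = down[unfolded d]
      show ?thesis
      proof (rule irr_shareE[OF d1(1) d2(1) d1(2) d2(2)])
        assume "v = z" then show ?thesis using assms d by simp
      next
        fix y \<theta> assume y: "v # \<alpha> \<approx> v # y # \<theta>" "z # \<beta> \<approx> z # y # \<theta>" "irr (v # y # \<theta>)" "irr (z # y # \<theta>)"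
        have "closes (v # y # \<theta>) (z # y # \<theta>) t"
          using square_same_level[OF y(3,4)] assms(3,4) d by simp
        then show ?thesis by (rule closes_eqv) (use y d in auto)
      qed
    qed
  next
    case h1: (hor x \<eta>)
    from assms(2) show ?thesis
    proof (cases rule: adjE)
      case up
      show ?thesis by (rule closes_sym[OF square_up[OF assms(2) up(2) assms(1,4,3)]])
    next
      case down
      show ?thesis by (rule hor_down[OF i(2,3) assms(3,4,6) h1(3,1,2) down])
    next
      case (hor x' \<eta>')
      have base: ?thesis if "x = x'" "\<eta> = \<eta>'"
      proof -
        have "closes (hd \<gamma> # x # \<eta>) (hd \<epsilon> # x # \<eta>) t"
          using square_same_level[OF h1(4) hor(4)[folded that] assms(3,4)] .
        then show ?thesis by (rule closes_eqv) (use h1(2) hor(2) that in auto)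
      qed
      show ?thesis
      \<comment> \<open>Comparing two representatives of \<delta> shows that \<gamma> and \<epsilon>
        have the same predecessor or share a vertex two steps down.\<close>
      proof (rule irr_shareE[OF h1(3) hor(3) h1(1) hor(1)])
        fix y \<theta> assume y: "x # \<eta> \<approx> x # y # \<theta>" "x' # \<eta>' \<approx> x' # y # \<theta>"
        have m: "\<gamma> \<approx> hd \<gamma> # x # y # \<theta>" "\<epsilon> \<approx> hd \<epsilon> # x' # y # \<theta>"
          using eqv_trans[OF h1(2) eqv_Cons[OF y(1)]] eqv_trans[OF hor(2) eqv_Cons[OF y(2)]] by auto
        have "closes (hd \<gamma> # x # y # \<theta>) (hd \<epsilon> # x' # y # \<theta>) t"
          by (rule square_two_levels[OF irr_eqv[OF i(2) m(1)] irr_eqv[OF i(3) m(2)] assms(3-6)])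
        then show ?thesis by (rule closes_eqv) (use m in auto)
      qed (use base in auto)
    qed
  qed
qed

text \<open>Coincident or adjacent opposite corners are handled by \<open>adj_unique\<close> and
  \<open>triangle\<close>, the induced case by \<open>square_induced\<close>. The corner found over
  \<open>hd \<tau>\<close> is equivalent to \<tau> because both are neighbours of
  \<epsilon>.\<close>

lemma square:
  assumes "adj \<gamma> \<delta>" "adj \<delta> \<epsilon>" "adj \<epsilon> \<tau>" "E (hd \<tau>) (hd \<gamma>)"
  shows "adj \<tau> \<gamma>"
proof -
  have e: "E (hd \<gamma>) (hd \<delta>)" "E (hd \<delta>) (hd \<epsilon>)" "E (hd \<epsilon>) (hd \<tau>)" "E (hd \<tau>) (hd \<gamma>)"
    using assms adj_irr by auto
  have "closes \<gamma> \<epsilon> (hd \<tau>)"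
  proof -
    consider "hd \<gamma> = hd \<epsilon>" | "E (hd \<gamma>) (hd \<epsilon>)" | "hd \<delta> = hd \<tau>" | "E (hd \<delta>) (hd \<tau>)"
      | "hd \<gamma> \<noteq> hd \<epsilon>" "\<not> E (hd \<gamma>) (hd \<epsilon>)" "hd \<delta> \<noteq> hd \<tau>" "\<not> E (hd \<delta>) (hd \<tau>)" by blast
    then show ?thesis
    proof cases
      case 1
      have "\<gamma> \<approx> \<epsilon>" by (rule adj_unique[OF adj_sym[OF assms(1)] assms(2) 1])
      then show ?thesis unfolding closes_def using assms(3) adj_eqv[OF assms(3), of \<gamma>] eqv_sym[of \<gamma> \<epsilon>] by blast
    next
      case 2
      then have a: "adj \<gamma> \<epsilon>" using triangle[OF adj_sym[OF assms(1)] assms(2)] by blast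
      then have "adj \<gamma> \<tau>" using triangle[OF adj_sym[OF a] assms(3) sym[OF e(4)]] by blast
      then show ?thesis unfolding closes_def using assms(3) by blast
    next
      case 3
      then have "closes \<gamma> \<epsilon> (hd \<delta>)" unfolding closes_def using assms(1) adj_sym[OF assms(2)] by blast
      then show ?thesis using 3 by simp
    next
      case 4
      obtain \<tau>' where t: "hd \<tau>' = hd \<tau>" "adj \<delta> \<tau>'" using adj_exists[of \<delta> "hd \<tau>"] adj_irr[OF assms(2)] sym[OF 4] by blast
      have "adj \<gamma> \<tau>'" using triangle[OF t(2) adj_sym[OF assms(1)]] t(1) e(4) adj_sym[of \<tau>' \<gamma>] by simp
      moreover have "adj \<epsilon> \<tau>'" using triangle[OF assms(2) t(2)] t(1) e(3) by simp
      ultimately show ?thesis unfolding closes_def using t by blast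
    next
      case 5
      then show ?thesis using square_induced[OF adj_sym[OF assms(1)] assms(2) e(4) sym[OF e(3)]] by blast
    qed
  qed
  then obtain \<tau>' where t: "hd \<tau>' = hd \<tau>" "adj \<gamma> \<tau>'" "adj \<epsilon> \<tau>'"
    unfolding closes_def by blast
  show ?thesis by (rule adj_sym[OF adj_eqv2[OF t(2) adj_unique[OF t(3) assms(3) t(1)]]])
qed

section \<open>Monodromy\<close>

text \<open>\<open>lift \<gamma> xs \<delta>\<close>: the lift of the walk \<open>xs\<close> to the universal cover that starts at the
  class of \<open>\<gamma>\<close> ends at the class of \<open>\<delta>\<close>.\<close>

fun lift :: "'a list \<Rightarrow> 'a list \<Rightarrow> 'a list \<Rightarrow> bool" where
  "lift \<gamma> [] \<delta> \<longleftrightarrow> False"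
| "lift \<gamma> [x] \<delta> \<longleftrightarrow> irr \<gamma> \<and> hd \<gamma> = x \<and> \<gamma> \<approx> \<delta>"
| "lift \<gamma> (x # y # xs) \<delta> \<longleftrightarrow> hd \<gamma> = x \<and> (\<exists>\<gamma>'. hd \<gamma>' = y \<and> adj \<gamma> \<gamma>' \<and> lift \<gamma>' (y # xs) \<delta>)"

lemma lift_hd: "lift \<gamma> (x # xs) \<delta> \<Longrightarrow> irr \<gamma> \<and> hd \<gamma> = x"
  by (cases xs) (auto dest: adj_irr)

lemma lift_eqv1:
  assumes "lift \<gamma> xs \<delta>" "\<gamma> \<approx> \<gamma>'"
  shows "lift \<gamma>' xs \<delta>"
proof (cases xs rule: walk.cases)
  case (2 x)
  then show ?thesis using assms irr_eqv[OF _ assms(2)] eqv_hd[OF assms(2)] eqv_trans[OF eqv_sym[OF assms(2)]] by simp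
next
  case (3 x y ys)
  then show ?thesis using assms(1) eqv_hd[OF assms(2)] adj_eqv[OF _ assms(2)] by auto
qed (use assms in simp)

lemma lift_eqv2: "lift \<gamma> xs \<delta> \<Longrightarrow> \<delta> \<approx> \<delta>' \<Longrightarrow> lift \<gamma> xs \<delta>'"
  by (induction \<gamma> xs \<delta> rule: lift.induct) (auto intro: eqv_trans)

lemma lift_append: "lift \<gamma> (as @ x # bs) \<delta> \<longleftrightarrow> (\<exists>\<mu>. lift \<gamma> (as @ [x]) \<mu> \<and> lift \<mu> (x # bs) \<delta>)"
proof (induction as arbitrary: \<gamma>)
  case Nil
  show ?case
  proof
    assume "lift \<gamma> ([] @ x # bs) \<delta>"
    then show "\<exists>\<mu>. lift \<gamma> ([] @ [x]) \<mu> \<and> lift \<mu> (x # bs) \<delta>"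
      using lift_hd[of \<gamma> x bs \<delta>] by (intro exI[of _ \<gamma>]) simp
  next
    assume "\<exists>\<mu>. lift \<gamma> ([] @ [x]) \<mu> \<and> lift \<mu> (x # bs) \<delta>"
    then show "lift \<gamma> ([] @ x # bs) \<delta>" using lift_eqv1 eqv_sym by auto
  qed
next
  case (Cons a as)
  obtain b cs ds where "as @ x # bs = b # cs" "as @ [x] = b # ds" by (cases as) auto
  then show ?case using Cons.IH by auto
qed

lemma lift_exists: "walk xs \<Longrightarrow> irr \<gamma> \<Longrightarrow> hd \<gamma> = hd xs \<Longrightarrow> \<exists>\<mu>. lift \<gamma> xs \<mu>"
proof (induction xs arbitrary: \<gamma> rule: walk.induct)
  case (3 a b xs)
  then obtain \<delta> where \<delta>: "hd \<delta> = b" "adj \<gamma> \<delta>" using adj_exists[of \<gamma> b] sym by auto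
  then obtain \<mu> where "lift \<delta> (b # xs) \<mu>" using 3 adj_irr[OF \<delta>(2)] by auto
  then have "lift \<gamma> (a # b # xs) \<mu>" using \<delta> 3(4) by auto
  then show ?case by blast
qed auto

text \<open>For the converse direction, a lift of the loop exists, its end is equivalent to its
  start, and the end of a lift may be replaced by any equivalent walk.\<close>

lemma lift_loop:
  assumes "walk (x # c)" "\<And>\<nu> \<mu>. lift \<nu> (x # c) \<mu> \<Longrightarrow> \<nu> \<approx> \<mu>"
  shows "lift \<nu> (x # c) \<mu> \<longleftrightarrow> lift \<nu> [x] \<mu>"
proof
  assume "lift \<nu> (x # c) \<mu>"
  then show "lift \<nu> [x] \<mu>" using lift_hd assms(2) by simp
next
  assume a: "lift \<nu> [x] \<mu>"
  then obtain \<mu>' where m: "lift \<nu> (x # c) \<mu>'" using lift_exists[OF assms(1)] by auto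
  have "\<mu>' \<approx> \<mu>" using a eqv_trans[OF eqv_sym[OF assms(2)[OF m]]] by simp
  then show "lift \<nu> (x # c) \<mu>" using lift_eqv2[OF m] by blast
qed

lemma lift_insert:
  assumes "\<And>\<nu> \<mu>. lift \<nu> (x # c @ [x]) \<mu> \<longleftrightarrow> lift \<nu> [x] \<mu>"
  shows "lift \<gamma> (as @ [x] @ bs) \<delta> \<longleftrightarrow> lift \<gamma> (as @ (x # c @ [x]) @ bs) \<delta>"
proof -
  have "lift \<gamma> (as @ (x # c @ [x])) \<mu> \<longleftrightarrow> lift \<gamma> (as @ [x]) \<mu>" for \<mu>
    using lift_append[of \<gamma> as x "c @ [x]" \<mu>] lift_append[of \<gamma> as x "[]" \<mu>] assms by simp
  then show ?thesis
    using lift_append[of \<gamma> "as @ x # c" x bs \<delta>] lift_append[of \<gamma> as x bs \<delta>] by simp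
qed

lemma lift_backtrack: "E x y \<Longrightarrow> lift \<nu> [x, y, x] \<mu> \<longleftrightarrow> lift \<nu> [x] \<mu>"
proof (rule lift_loop)
  fix \<nu> \<mu> assume "lift \<nu> [x, y, x] \<mu>"
  then obtain \<gamma> \<gamma>' where g: "hd \<nu> = x" "adj \<nu> \<gamma>" "adj \<gamma> \<gamma>'" "hd \<gamma>' = x" "\<gamma>' \<approx> \<mu>" by auto
  then have "\<nu> \<approx> \<gamma>'" using adj_unique[OF adj_sym[OF g(2)] g(3)] by simp
  then show "\<nu> \<approx> \<mu>" using g(5) by (rule eqv_trans)
qed (simp add: sym)

lemma lift_triangle:
  assumes "walk [a, b, c, a]"
  shows "lift \<nu> [a, b, c, a] \<mu> \<longleftrightarrow> lift \<nu> [a] \<mu>"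
proof (rule lift_loop[OF assms])
  fix \<nu> \<mu> assume "lift \<nu> [a, b, c, a] \<mu>"
  then obtain \<beta> \<gamma> \<alpha> where g: "hd \<nu> = a" "hd \<beta> = b" "adj \<nu> \<beta>" "adj \<beta> \<gamma>" "hd \<gamma> = c" "adj \<gamma> \<alpha>" "hd \<alpha> = a" "\<alpha> \<approx> \<mu>"
    by auto
  have "adj \<nu> \<gamma>" using triangle[OF adj_sym[OF g(3)] g(4)] g assms sym by simp
  then have "\<nu> \<approx> \<alpha>" using adj_unique[OF adj_sym g(6)] g by simp
  then show "\<nu> \<approx> \<mu>" using g(8) by (rule eqv_trans)
qed

lemma lift_square:
  assumes "walk [a, b, c, d, a]"
  shows "lift \<nu> [a, b, c, d, a] \<mu> \<longleftrightarrow> lift \<nu> [a] \<mu>"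
proof (rule lift_loop[OF assms])
  fix \<nu> \<mu> assume "lift \<nu> [a, b, c, d, a] \<mu>"
  then obtain \<beta> \<gamma> \<delta> \<alpha> where g: "hd \<nu> = a" "hd \<beta> = b" "adj \<nu> \<beta>" "adj \<beta> \<gamma>" "hd \<gamma> = c" "adj \<gamma> \<delta>" "hd \<delta> = d"
    "adj \<delta> \<alpha>" "hd \<alpha> = a" "\<alpha> \<approx> \<mu>"
    by auto
  have "adj \<delta> \<nu>" using square[OF g(3,4,6)] g assms by simp
  then have "\<nu> \<approx> \<alpha>" using adj_unique[OF _ g(8)] g by simp
  then show "\<nu> \<approx> \<mu>" using g(10) by (rule eqv_trans)
qed

text \<open>Cells enter through their number of vertices, which lets the complex be the
  triangle-square complex or the cell set of a covering.\<close>

lemma lift_cell_loop: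
  assumes "cell_loop E K c" "card K = 3 \<or> card K = 4"
  shows "\<exists>x d. c = x # d @ [x] \<and> (\<forall>\<nu> \<mu>. lift \<nu> c \<mu> \<longleftrightarrow> lift \<nu> [x] \<mu>)"
proof -
  have c: "walk c" "length c = Suc (card K)" "hd c = last c"
    using assms(1) unfolding cell_loop_def is_walk_iff_walk by auto
  from assms(2) show ?thesis
  proof
    assume "card K = 3"
    then obtain x y z w where "c = [x, y, z, w]" using c(2) by (auto simp: length_Suc_conv numeral_eq_Suc)
    then show ?thesis using c lift_triangle by (intro exI[of _ x] exI[of _ "[y, z]"]) auto
  next
    assume "card K = 4"
    then obtain x y z t w where "c = [x, y, z, t, w]" using c(2) by (auto simp: length_Suc_conv numeral_eq_Suc)
    then show ?thesis using c lift_square by (intro exI[of _ x] exI[of _ "[y, z, t]"]) auto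
  qed
qed

lemma lift_htpy_step:
  assumes "htpy_step E D xs ys" "\<forall>K\<in>D. card K = 3 \<or> card K = 4"
  shows "lift \<gamma> xs \<delta> \<longleftrightarrow> lift \<gamma> ys \<delta>"
  using assms(1) unfolding htpy_step_def
proof (elim disjE exE conjE)
  fix as bs x y
  assume "E x y" "xs = as @ [x] @ bs" "ys = as @ [x, y, x] @ bs"
  then show ?thesis using lift_insert[of x "[y]" \<gamma> as bs \<delta>] lift_backtrack[of x y] by simp
next
  fix as bs K c
  assume a: "K \<in> D" "cell_loop E K c" "xs = as @ [hd c] @ bs" "ys = as @ c @ bs"
  obtain x d where c: "c = x # d @ [x]" "\<And>\<nu> \<mu>. lift \<nu> c \<mu> \<longleftrightarrow> lift \<nu> [x] \<mu>"
    using lift_cell_loop[OF a(2) assms(2)[rule_format, OF a(1)]] by blast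
  show ?thesis using lift_insert[OF c(2)[unfolded c(1)], of \<gamma> as bs \<delta>] a c(1) by simp
qed

lemma lift_htpy:
  assumes "(\<lambda>a b. htpy_step E D a b \<or> htpy_step E D b a)\<^sup>*\<^sup>* xs ys"
    and "\<forall>K\<in>D. card K = 3 \<or> card K = 4"
  shows "lift \<gamma> xs \<delta> \<longleftrightarrow> lift \<gamma> ys \<delta>"
  using assms(1)
proof (induction rule: rtranclp_induct)
  case (step ys zs)
  then show ?case using lift_htpy_step[OF _ assms(2)] by blast
qed simp

section \<open>Irreducible walks in simply connected complexes\<close>

text \<open>The lift runs through the tails of \<gamma>, each one step below the previous
  one.\<close>

lemma lift_down: "irr \<gamma> \<Longrightarrow> lift \<gamma> \<gamma> [last \<gamma>]"
proof (induction \<gamma> rule: walk.induct)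
  case (3 a b xs)
  have "adj (a # b # xs) (b # xs)" using adj_sym[OF adj_up[OF 3(2)]] by simp
  then show ?case using 3(1)[OF irr_tl[OF 3(2)]] by (auto intro!: exI[of _ "b # xs"])
qed (use irr_ne irr_single in auto)

lemma lift_up: "irr \<gamma> \<Longrightarrow> lift [last \<gamma>] (rev \<gamma>) \<gamma>"
proof (induction \<gamma> rule: walk.induct)
  case (3 a b xs)
  have "adj (b # xs) (a # b # xs)" using adj_up[OF 3(2)] by simp
  then have "lift (b # xs) [b, a] (a # b # xs)" using 3(2) by (auto intro!: exI[of _ "a # b # xs"])
  then show ?case using 3(1)[OF irr_tl[OF 3(2)]] lift_append[of "[last (a # b # xs)]" "rev xs" b "[a]" "a # b # xs"] by auto
qed (use irr_ne irr_single in auto)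

text \<open>Following \<delta> back to \<open>u\<close> and then \<gamma> outwards gives a closed
  walk, hence a contractible one. Its lift from \<delta> descends to \<open>[u]\<close> and climbs
  to \<gamma>, while the contracted walk lifts to a constant; homotopy invariance identifies the two
  ends.\<close>

lemma irr_unique:
  assumes "simply_connected E D" "\<forall>K\<in>D. card K = 3 \<or> card K = 4"
    and "irr \<gamma>" "irr \<delta>" "hd \<gamma> = hd \<delta>" "last \<gamma> = last \<delta>"
  shows "\<delta> \<approx> \<gamma>"
proof -
  define u where "u = last \<gamma>"
  obtain as where d: "\<delta> = as @ [u]" using irr_ne[OF assms(4)] assms(6) u_def by (metis append_butlast_last_id)
  obtain bs where g: "rev \<gamma> = u # bs"
    using irr_ne[OF assms(3)] u_def by (metis hd_rev list.exhaust_sel rev_is_Nil_conv)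
  have w: "is_walk E (as @ u # bs)"
    using irr_walk[OF assms(4)] walk_rev[OF irr_walk[OF assms(3)]] d g walk_append[of as u bs] unfolding is_walk_iff_walk by simp
  have h: "hd (as @ u # bs) = hd \<gamma>" using d assms(5) by (cases as) auto
  have "last (as @ u # bs) = last (rev \<gamma>)" using g by simp
  then have l: "last (as @ u # bs) = hd \<gamma>" using irr_ne[OF assms(3)] by (simp add: last_rev)
  have "(\<lambda>a b. htpy_step E D a b \<or> htpy_step E D b a)\<^sup>*\<^sup>* (as @ u # bs) [hd \<gamma>]"
    using assms(1) w h l unfolding simply_connected_def by metis
  then have "lift \<delta> (as @ u # bs) \<gamma> \<longleftrightarrow> lift \<delta> [hd \<gamma>] \<gamma>" using assms(2) by (rule lift_htpy)
  moreover have "lift \<delta> (as @ [u]) [u]" using lift_down[OF assms(4)] d by simp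
  moreover have "lift [u] (u # bs) \<gamma>" using lift_up[OF assms(3)] g u_def by simp
  ultimately have "lift \<delta> [hd \<gamma>] \<gamma>" using lift_append[of \<delta> as u bs \<gamma>] by blast
  then show ?thesis by simp
qed

text \<open>A reducible walk can be shortened with the same ends, while moves preserve length and
  ends.\<close>

lemma geodesic_irr:
  assumes "geodesic \<gamma>"
  shows "irr \<gamma>"
proof -
  have short: "\<exists>ys. walk ys \<and> hd ys = hd xs \<and> last ys = last xs \<and> length ys < length xs" if "reducible xs" "walk xs" for xs
    using that
  proof (induction xs rule: reducible.induct)
    case (1 a b c xs)
    show ?case
    proof (cases "a = c \<or> E a c")
      case True
      then show ?thesis using 1(3)
        by (elim disjE) (rule exI[of _ "c # xs"], simp, rule exI[of _ "a # c # xs"], simp)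
    next
      case False
      then obtain ys where ys: "walk ys" "hd ys = b" "last ys = last (b # c # xs)" "length ys < length (b # c # xs)"
        using 1 by auto
      then show ?thesis using 1(3) walk_ne by (intro exI[of _ "a # ys"]) (cases ys, auto)
    qed
  qed auto
  have "\<not> reducible ys" if "\<gamma> \<approx> ys" for ys
  proof
    assume "reducible ys"
    moreover have w: "walk ys" using eqv_walk[OF that] assms unfolding geodesic_def by blast
    ultimately obtain zs where z: "walk zs" "hd zs = hd ys" "last zs = last ys" "length zs < length ys"
      using short by blast
    show False
      using gdist_less_length[OF z(1)] z eqv_hd[OF that] eqv_last[OF that] eqv_length[OF that] assms
      unfolding geodesic_def by simp
  qed
  then show ?thesis using assms unfolding irr_def geodesic_def by blast
qed

lemma adj_last: "adj \<gamma> \<delta> \<Longrightarrow> last \<gamma> = last \<delta>"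
proof -
  assume a: "adj \<gamma> \<delta>"
  then have ne: "\<gamma> \<noteq> []" "\<delta> \<noteq> []" using adj_irr irr_ne by blast+
  show ?thesis
    using a by (cases rule: adjE) (use ne in \<open>auto dest!: eqv_last\<close>)
qed

text \<open>Irreducible walks with the same ends are equivalent, hence of equal length, so they are
  the geodesics. Horizontal adjacency then gives TC, and the quadrangle condition for walks gives
  QC.\<close>

lemma simply_connected_weakly_modular:
  assumes "simply_connected E D" "\<forall>K\<in>D. card K = 3 \<or> card K = 4"
  shows "weakly_modular E"
proof -
  note unique = irr_unique[OF assms]
  have irr_geodesic: "geodesic \<gamma>" if i: "irr \<gamma>" for \<gamma>
  proof -
    obtain \<delta> where d: "geodesic \<delta>" "last \<delta> = last \<gamma>" "hd \<delta> = hd \<gamma>" using ex_geodesic by blast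
    have "\<delta> \<approx> \<gamma>" using unique[OF i geodesic_irr[OF d(1)]] d by simp
    from eqv_length[OF this] show ?thesis using d irr_walk[OF i] unfolding geodesic_def by simp
  qed
  show ?thesis
    unfolding weakly_modular_def
  proof (intro allI conjI)
    fix u
    show "TC E u"
      unfolding TC_def
    proof (intro allI impI)
      fix v w assume a: "gdist E v w = 1 \<and> 1 < gdist E u v \<and> gdist E u v = gdist E u w"
      obtain \<gamma> where g: "geodesic \<gamma>" "last \<gamma> = u" "hd \<gamma> = v" using ex_geodesic by blast
      have "E w v" using a gdist_1 sym by blast
      then obtain \<tau> where t: "hd \<tau> = w" "adj \<gamma> \<tau>" using adj_exists[OF geodesic_irr[OF g(1)]] g by blast
      have lt: "last \<tau> = u" using adj_last t g by simp
      have i: "irr \<gamma>" "irr \<tau>" using adj_irr t by auto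
      have len: "length \<tau> = length \<gamma>" using irr_geodesic[OF i(2)] g a t lt unfolding geodesic_def by simp
      \<comment> \<open>Both walks have the same length, so only the horizontal case survives, and
        the common predecessor is the required vertex.\<close>
      from t(2) show "\<exists>x. E x v \<and> E x w \<and> gdist E u x = gdist E u v - 1"
      proof (cases rule: adjE)
        case up
        then show ?thesis using len eqv_length[OF up(2)] by simp
      next
        case down
        then show ?thesis using len eqv_length[OF down(2)] by simp
      next
        case (hor x \<eta>)
        have l: "last (x # \<eta>) = u" using eqv_last[OF hor(1)] g by simp
        have "geodesic (v # x # \<eta>)" using irr_geodesic[OF hor(3)] g by simp
        then have "gdist E u v = Suc (gdist E u x)" using geodesic_tl(2)[of v x \<eta>] l by simp
        then show ?thesis using irr_edge[OF hor(3)] irr_edge[OF hor(4)] g t by auto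
      qed
    qed
    show "QC E u"
      unfolding QC_def
    proof (intro allI impI)
      fix v w z
      assume a: "gdist E v z = 1 \<and> gdist E w z = 1 \<and> gdist E v w = 2 \<and> gdist E v w \<le> gdist E u v \<and>
        gdist E u v = gdist E u w \<and> gdist E u z = gdist E u v + 1"
      have e: "E z v" "E z w" using a gdist_1 sym by blast+
      obtain \<gamma> where g: "geodesic \<gamma>" "last \<gamma> = u" "hd \<gamma> = v" using ex_geodesic by blast
      obtain \<delta> where d: "geodesic \<delta>" "last \<delta> = u" "hd \<delta> = w" using ex_geodesic by blast
      obtain \<alpha> where \<gamma>: "\<gamma> = v # \<alpha>" using g walk_ne unfolding geodesic_def by (cases \<gamma>) auto
      obtain \<beta> where \<delta>: "\<delta> = w # \<beta>" using d walk_ne unfolding geodesic_def by (cases \<delta>) auto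
      have gg: "geodesic (z # v # \<alpha>)" using geodesic_Cons[of v \<alpha> z] g \<gamma> e a by simp
      have gd: "geodesic (z # w # \<beta>)" using geodesic_Cons[of w \<beta> z] d \<delta> e a by simp
      note i = geodesic_irr[OF gg] geodesic_irr[OF gd]
      \<comment> \<open>Two geodesics to \<open>z\<close>, one through \<open>v\<close> and one
        through \<open>w\<close>, are equivalent; \<open>shareE\<close> then provides the vertex
        closer to \<open>u\<close>.\<close>
      have "z # v # \<alpha> \<approx> z # w # \<beta>" using unique[OF i(2,1)] g d \<gamma> \<delta> by simp
      from i(1) this show "\<exists>x. E x v \<and> E x w \<and> gdist E u x = gdist E u v - 1"
      proof (rule shareE)
        assume "v = w" then show ?thesis using a gdist_0[of v w] by simp
      next
        fix x \<eta> assume x: "v # \<alpha> \<approx> v # x # \<eta>" "w # \<beta> \<approx> w # x # \<eta>"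
        have iv: "irr (v # x # \<eta>)" and iw: "irr (w # x # \<eta>)" using x i irr_tl irr_eqv by blast+
        have l: "last (x # \<eta>) = u" using eqv_last[OF x(1)] g \<gamma> by simp
        have "gdist E u v = Suc (gdist E u x)" using geodesic_tl(2)[OF irr_geodesic[OF iv]] l by simp
        then show ?thesis using irr_edge[OF iv] irr_edge[OF iw] by auto
      qed
    qed
  qed
qed

end

section \<open>Coverings\<close>

context connected_simple_graph
begin

lemma lwm_graph:
  assumes "locally_weakly_modular E"
  shows "lwm_graph E"
proof
  fix v w y a b
  assume "E v w" "y \<noteq> v" "\<not> E y v" "y \<noteq> w" "\<not> E y w" "E y a" "E a v" "E y b" "E b w"
  then show "\<exists>x. E x y \<and> E x v \<and> E x w"
    using assms gdist_2[of y v] gdist_2[of y w] unfolding locally_weakly_modular_def LTC_def by blast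
next
  fix z v w y a b
  assume a: "E z v" "E z w" "v \<noteq> w" "\<not> E v w" "y \<noteq> v" "\<not> E y v" "y \<noteq> w" "\<not> E y w"
    "E y a" "E a v" "E y b" "E b w" "y \<noteq> z" "\<not> E y z" "\<forall>c. \<not> (E y c \<and> E c z)"
  have 2: "gdist E v w = 2" "gdist E y v = 2" "gdist E y w = 2" using a gdist_2 sym by blast+
  have "gdist E y z \<noteq> 0" "gdist E y z \<noteq> 1" "gdist E y z \<noteq> 2" "gdist E y z \<le> 3"
    using a gdist_0[of y z] gdist_1[of y z] gdist_2[of y z] gdist_step[of z v y] 2(2) by auto
  then have "gdist E y z = 3" by linarith
  then show "\<exists>x. E x y \<and> E x v \<and> E x w"
    using assms 2 a(1,2) unfolding locally_weakly_modular_def LQC_def by blast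
qed

end

locale covering_graph = E: lwm_graph E + F: connected_simple_graph F
  for E :: "'a \<Rightarrow> 'a \<Rightarrow> bool" and F :: "'b \<Rightarrow> 'b \<Rightarrow> bool" +
  fixes D :: "'b set set" and p :: "'b \<Rightarrow> 'a"
  assumes covering: "is_covering F D E (tsq_cells E) p"
begin

lemma edge: "F x y \<Longrightarrow> E (p x) (p y)"
  using covering unfolding is_covering_def by blast

lemma inj_star: "inj_on p (star_vs F D v)"
  using covering unfolding is_covering_def by blast

lemma image_star: "p ` star_vs F D v = star_vs E (tsq_cells E) (p v)"
  using covering unfolding is_covering_def by blast

lemma star_edge_iff:
  "x \<in> star_vs F D v \<Longrightarrow> y \<in> star_vs F D v \<Longrightarrow>
    star_edge F D v x y \<longleftrightarrow> star_edge E (tsq_cells E) (p v) (p x) (p y)"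
  using covering unfolding is_covering_def by blast

lemma nbr_star: "F v x \<Longrightarrow> x \<in> star_vs F D v"
  unfolding star_vs_def by blast

lemma inj_nbr: "F v x \<Longrightarrow> F v y \<Longrightarrow> p x = p y \<Longrightarrow> x = y"
  using inj_onD[OF inj_star] nbr_star by blast

text \<open>Surjectivity on stars gives a preimage in the star of \<open>v\<close>, possibly across
  a cell; reflection of star edges makes it a neighbour.\<close>

lemma lift_nbr:
  assumes "E (p v) x"
  obtains x' where "F v x'" "p x' = x"
proof -
  have "x \<in> star_vs E (tsq_cells E) (p v)" unfolding star_vs_def using assms by blast
  then have "x \<in> p ` star_vs F D v" unfolding image_star .
  then obtain x' where x': "x' \<in> star_vs F D v" "p x' = x" by blast
  have "star_edge E (tsq_cells E) (p v) (p v) (p x')" using assms x' unfolding star_edge_def by blast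
  moreover have "v \<in> star_vs F D v" unfolding star_vs_def by blast
  ultimately have "star_edge F D v v x'" using star_edge_iff x' by blast
  then show thesis using that x' unfolding star_edge_def by blast
qed

text \<open>The images form a triangle cell, so the edge from \<open>p x\<close> to
  \<open>p y\<close> lies in the star of \<open>p v\<close>, and the star isomorphism at
  \<open>v\<close> reflects it.\<close>

lemma reflect_triangle:
  assumes "F v x" "F v y" "E (p x) (p y)"
  shows "F x y"
proof -
  have "{p v, p x, p y} \<in> tsq_cells E"
    unfolding tsq_cells_def using edge[OF assms(1)] edge[OF assms(2)] assms(3) by blast
  then have "star_edge E (tsq_cells E) (p v) (p x) (p y)" using assms(3) unfolding star_edge_def by blast
  then have "star_edge F D v x y" using star_edge_iff nbr_star assms by blast
  then show ?thesis unfolding star_edge_def by blast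
qed

lemma path_induced:
  assumes "F x y" "F y z" "x \<noteq> z" "\<not> F x z"
  shows "p x \<noteq> p z" "\<not> E (p x) (p z)"
  using inj_nbr[of y x z] reflect_triangle[of y x z] assms F.sym by blast+

text \<open>Lift \<open>x\<close> to a neighbour \<open>x'\<close> of \<open>a\<close>. If
  \<open>x\<close> equals \<open>p b\<close> or is adjacent to it, injectivity on neighbours and
  reflected triangles join \<open>x'\<close> to \<open>c\<close>. Otherwise \<open>p a\<close>,
  \<open>p b\<close>, \<open>p c\<close> and \<open>x\<close> span a square, whose lift at
  \<open>a\<close> contains the edge from \<open>x'\<close> to \<open>c\<close>.\<close>

lemma lift_square:
  assumes "F a b" "F b c" "a \<noteq> c" "\<not> F a c" "E (p a) x" "E x (p c)"
  obtains x' where "F a x'" "F x' c" "p x' = x"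
proof -
  note n = path_induced[OF assms(1-4)]
  obtain x' where x': "F a x'" "p x' = x" using lift_nbr[OF assms(5)] by blast
  consider "x = p b" | "E x (p b)" | "x \<noteq> p b" "\<not> E x (p b)" by blast
  then have "F x' c"
  proof cases
    case 1
    then have "x' = b" using inj_nbr[OF x'(1) assms(1)] x' by simp
    then show ?thesis using assms by simp
  next
    case 2
    then have "F x' b" using reflect_triangle[OF x'(1) assms(1)] x' by simp
    then show ?thesis using reflect_triangle[of b x' c] x' assms F.sym by blast
  next
    case 3
    define L where L: "L = {p a, p b, p c, x}"
    then have in_L: "p a \<in> L" "p b \<in> L" "p c \<in> L" "x \<in> L" by simp_all
    have cell: "L \<in> tsq_cells E"
      unfolding tsq_cells_def L using edge[OF assms(1)] edge[OF assms(2)] assms(5,6) n 3 E.sym by blast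
    moreover have "bij_betw (image p) {K \<in> D. a \<in> K} {L \<in> tsq_cells E. p a \<in> L}"
      using covering unfolding is_covering_def by blast
    ultimately have "L \<in> image p ` {K \<in> D. a \<in> K}" using in_L(1) unfolding bij_betw_def by blast
    then obtain K where K: "K \<in> D" "a \<in> K" "p ` K = L" by auto
    have sub: "K \<subseteq> star_vs F D a" using K unfolding star_vs_def by blast
    have in_K: "y \<in> K" if "F a y" "p y \<in> L" for y
    proof -
      have "p y \<in> p ` K" using that(2) K(3) by simp
      then obtain y' where y': "p y = p y'" "y' \<in> K" by (rule imageE)
      then have "y = y'" using inj_onD[OF inj_star y'(1) nbr_star[OF that(1)]] sub by blast
      then show ?thesis using y' by simp
    qed
    have b: "b \<in> K" using in_K assms(1) in_L by blast
    have x: "x' \<in> K" using in_K x' in_L by simp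
    have "p c \<in> p ` K" using K(3) in_L by simp
    then obtain c' where c': "p c = p c'" "c' \<in> K" by (rule imageE)
    have F_K: "F y z" if "E (p y) (p z)" "y \<in> K" "z \<in> K" for y z
    proof -
      have "p y \<in> L" "p z \<in> L" using that K(3) by auto
      then have "star_edge E (tsq_cells E) (p a) (p y) (p z)"
        using that(1) cell in_L(1) unfolding star_edge_def by blast
      then have "star_edge F D a y z" using star_edge_iff[of y a z] sub that by blast
      then show ?thesis unfolding star_edge_def by blast
    qed
    \<comment> \<open>Both \<open>c\<close> and \<open>c'\<close> are neighbours of \<open>b\<close>
      over the same vertex, which identifies \<open>c\<close> as the corner of \<open>K\<close>
      opposite to \<open>a\<close>.\<close>
    have "F b c'" using F_K[OF _ b c'(2)] edge[OF assms(2)] c'(1) by simp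
    then have "c' = c" using inj_nbr[OF _ assms(2)] c'(1) by simp
    then show ?thesis using F_K[OF _ x c'(2)] assms(6) x'(2) by simp
  qed
  then show thesis using that x' by blast
qed

text \<open>The configuration is mapped down, the local condition of the base is applied, and the
  common neighbour is lifted by \<open>lift_square\<close>. For LQC it must be shown that
  \<open>p\<close> does not shorten the distance three between \<open>y\<close> and
  \<open>z\<close>.\<close>

lemma lwm_cover: "lwm_graph F"
proof
  fix v w y a b
  assume a: "F v w" "y \<noteq> v" "\<not> F y v" "y \<noteq> w" "\<not> F y w" "F y a" "F a v" "F y b" "F b w"
  note n = path_induced[OF a(6,7,2,3)] path_induced[OF a(8,9,4,5)]
  obtain x where x: "E x (p y)" "E x (p v)" "E x (p w)"
    using E.ltc[OF edge[OF a(1)] n edge[OF a(6)] edge[OF a(7)] edge[OF a(8)] edge[OF a(9)]] by blast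
  obtain x' where x': "F y x'" "F x' v" "p x' = x" using lift_square[OF a(6,7,2,3) E.sym[OF x(1)] x(2)] by blast
  have "F x' w" using reflect_triangle[of v x' w] x' x a(1) F.sym by blast
  then show "\<exists>x. F x y \<and> F x v \<and> F x w" using x' F.sym by blast
next
  fix z v w y a b
  assume a: "F z v" "F z w" "v \<noteq> w" "\<not> F v w" "y \<noteq> v" "\<not> F y v" "y \<noteq> w" "\<not> F y w"
    "F y a" "F a v" "F y b" "F b w" "y \<noteq> z" "\<not> F y z" and no: "\<forall>c. \<not> (F y c \<and> F c z)"
  have vz: "F v z" using a F.sym by blast
  note nv = path_induced[OF a(9,10,5,6)] and nw = path_induced[OF a(11,12,7,8)]
    and nvw = path_induced[OF vz a(2,3,4)]
  have az: "a \<noteq> z" "\<not> F a z" using a no by blast+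
  have n1: "p y \<noteq> p z" using nv edge[OF a(1)] by auto
  \<comment> \<open>Such an edge would lift to one joining \<open>z\<close> to a neighbour of
    \<open>a\<close> over \<open>p y\<close>, that is, to \<open>y\<close> itself.\<close>
  have n2: "\<not> E (p y) (p z)"
  proof
    assume "E (p y) (p z)"
    then obtain y' where y': "F a y'" "F y' z" "p y' = p y"
      using lift_square[OF a(10) vz az E.sym[OF edge[OF a(9)]]] by blast
    have "y' = y" using inj_nbr[OF y'(1) F.sym[OF a(9)] y'(3)] .
    then show False using y' a by simp
  qed
  \<comment> \<open>LTC in the base would give a common neighbour of the images of \<open>y\<close>,
    \<open>v\<close> and \<open>z\<close>, and its lift would be a common neighbour of
    \<open>y\<close> and \<open>z\<close>.\<close>
  have n3: "\<not> (E (p y) c \<and> E c (p z))" for c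
  proof
    assume c: "E (p y) c \<and> E c (p z)"
    then obtain x where x: "E x (p y)" "E x (p v)" "E x (p z)"
      using E.ltc[OF edge[OF vz] nv n1 n2 edge[OF a(9)] edge[OF a(10)]] by blast
    obtain x' where x': "F y x'" "F x' v" "p x' = x" using lift_square[OF a(9,10,5,6) E.sym[OF x(1)] x(2)] by blast
    have "F x' z" using reflect_triangle[of v x' z] x' x vz F.sym by blast
    then show False using no x' by blast
  qed
  obtain x where x: "E x (p y)" "E x (p v)" "E x (p w)"
    using E.lqc[OF edge[OF a(1)] edge[OF a(2)] nvw nv nw edge[OF a(9)] edge[OF a(10)] edge[OF a(11)] edge[OF a(12)] n1 n2]
      n3 by blast
  obtain x' where x': "F y x'" "F x' v" "p x' = x" using lift_square[OF a(9,10,5,6) E.sym[OF x(1)] x(2)] by blast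
  obtain x'' where x'': "F y x''" "F x'' w" "p x'' = x" using lift_square[OF a(11,12,7,8) E.sym[OF x(1)] x(3)] by blast
  have "x' = x''" using inj_nbr x' x'' by blast
  then show "\<exists>x. F x y \<and> F x v \<and> F x w" using x' x'' F.sym by blast
qed

end

lemma tsq_cells_card:
  assumes "sgraph E" "K \<in> tsq_cells E"
  shows "card K = 3 \<or> card K = 4"
proof -
  have "x \<noteq> y" if "E x y" for x y using assms(1) that unfolding sgraph_def by blast
  then have "card {a, b, c} = 3" if "E a b" "E b c" "E a c" for a b c
    using that by (auto simp: card_insert_if)
  moreover have "card {a, b, c, d} = 4" if "E a b" "E b c" "E c d" "E d a" "a \<noteq> c" "b \<noteq> d" for a b c d
    using that \<open>\<And>x y. E x y \<Longrightarrow> x \<noteq> y\<close> by (auto simp: card_insert_if)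
  ultimately show ?thesis using assms(2) unfolding tsq_cells_def by blast
qed

text \<open>\<open>K\<close> lies in the star of each of its vertices, where \<open>p\<close> is
  injective, so it has the size of its image cell.\<close>

lemma covering_cells_card:
  assumes "sgraph E" "is_covering F D E (tsq_cells E) p" "K \<in> D"
  shows "card K = 3 \<or> card K = 4"
proof -
  have pK: "p ` K \<in> tsq_cells E" using assms(2,3) unfolding is_covering_def by blast
  then obtain v where v: "v \<in> K" using tsq_cells_card[OF assms(1)] by fastforce
  have "inj_on p (star_vs F D v)" using assms(2) unfolding is_covering_def by blast
  then have "inj_on p K" by (rule inj_on_subset) (use v assms(3) in \<open>auto simp: star_vs_def\<close>)
  then show ?thesis using tsq_cells_card[OF assms(1) pK] card_image by metis
qed

theorem theorem3p1:
  fixes E :: "'a \<Rightarrow> 'a \<Rightarrow> bool" and F :: "'b \<Rightarrow> 'b \<Rightarrow> bool"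
    and D :: "'b set set" and p :: "'b \<Rightarrow> 'a"
  assumes "sgraph E" and "connected_graph E"
  shows "(locally_weakly_modular E \<and> sgraph F \<and> is_covering F D E (tsq_cells E) p \<and>
            simply_connected F D \<longrightarrow> weakly_modular F) \<and>
         (weakly_modular E \<longleftrightarrow>
            locally_weakly_modular E \<and> simply_connected E (tsq_cells E))"
proof (intro conjI impI iffI)
  interpret E: connected_simple_graph E by unfold_locales (fact assms)+
  {
    assume a: "locally_weakly_modular E \<and> sgraph F \<and> is_covering F D E (tsq_cells E) p \<and> simply_connected F D"
    interpret E': lwm_graph E using E.lwm_graph a by blast
    interpret cov: covering_graph E F D p
      by unfold_locales (use a in \<open>auto simp: simply_connected_def\<close>)
    \<comment> \<open>The criterion is applied inside \<open>F\<close>, which inherits local weak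
      modularity from \<open>E\<close>; the cells in \<open>D\<close> contract its closed
      walks.\<close>
    show "weakly_modular F"
      using lwm_graph.simply_connected_weakly_modular[OF cov.lwm_cover] covering_cells_card[OF assms(1)] a by blast
  next
    assume "weakly_modular E"
    then show "locally_weakly_modular E" "simply_connected E (tsq_cells E)"
      using E.wm_locally_wm E.wm_simply_connected by blast+
  next
    assume "locally_weakly_modular E \<and> simply_connected E (tsq_cells E)"
    then show "weakly_modular E"
      using lwm_graph.simply_connected_weakly_modular[OF E.lwm_graph] tsq_cells_card[OF assms(1)] by blast
  }
qed

end
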